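(* Let $\partial:M\to L$ be a crossed module and let $\Pi$ be a group. There are bijections $$\mathbf{Ext}_{\partial}(\Pi,M)\cong \widehat{\pi}^2(C^*(\Pi,M\xrightarrow{\partial} L))\qquad\text{and}\qquad \mathbf{wExt}_{\partial}(\Pi,M)\cong \pi^2(C^*(\Pi,M\xrightarrow{\partial} L)).$$
   Context: Conventions: $M$ (not necessarily abelian) and middle terms $B$ of extensions are written additively; $\Pi$ and $L$ multiplicatively. A crossed module $\partial:M\to L$ is a group homomorphism with an action $(x,m)\mapsto xm$ of $L$ on $M$ by automorphisms such that $\partial(xm)=x\,\partial(m)\,x^{-1}$ and $\partial(n)m=n+m-n$. Let $\rho:L\to \mathrm{Aut}(M)$, $\rho(x)(m)=xm$. An $(M\xrightarrow{\partial}L)$-extension of $\Pi$ by $M$ is a short exact sequence of groups $1\to M\xrightarrow{\kappa} B\xrightarrow{\sigma}\Pi\to 1$ together with a homomorphism $\varrho:B\to L$ such that $\varrho\circ\kappa=\partial$ and $b+m-b=\varrho(b)m$ for all $b\in B$, $m\in M$ (identifying $M$ with $\kappa(M)$). Two such extensions $(B,\varrho)$, $(B',\varrho')$ are congruent if there is a homomorphism $\alpha:B\to B'$ with $\alpha\kappa=\kappa'$, $\sigma'\alpha=\sigma$, $\varrho'\alpha=\varrho$. They are weakly congruent if there are an isomorphism $\alpha:B\to B'$ and an element $\tau\in L$ such that $\alpha\kappa=\kappa'\rho(\tau)$, $\sigma'\alpha=\sigma$ and $\tau^{-1}\varrho'(\alpha(b))\tau=\varrho(b)$ for all $b\in B$.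 $\mathbf{Ext}_\partial(\Pi,M)$ and $\mathbf{wExt}_\partial(\Pi,M)$ denote the sets of congruence classes and of weak congruence classes. A 2-cocycle of $\Pi$ with coefficients in $M\xrightarrow{\partial}L$ (with $\Pi$ acting trivially on $M$ and $L$) is a pair $(f,\phi)$ of maps $f:\Pi\times\Pi\to M$, $\phi:\Pi\to L$ with $$\phi(xy)=\partial(f(x,y))\phi(x)\phi(y),\qquad f(xy,z)+f(x,y)=f(x,yz)+\phi(x)f(y,z)$$ for all $x,y,z\in \Pi$. The set of these is $Z^2$. Write $(f',\phi')\sim(f,\phi)$ if there is a map $t:\Pi\to M$ with $$f'(x,y)=-t(xy)+f(x,y)+t(x)+\phi'(x)t(y),\qquad \phi(x)=\partial(t(x))\phi'(x)$$ for all $x,y$, and $(f',\phi')\simeq(f,\phi)$ if there are a map $t:\Pi\to M$ and $\tau\in L$ with $$f'(x,y)=-t(xy)+\tau f(x,y)+t(x)+\phi'(x)t(y),\qquad \phi(x)=\tau^{-1}\partial(t(x))\phi'(x)\tau$$ for all $x,y$. These are equivalence relations, and $\widehat{\pi}^2(C^*(\Pi,M\xrightarrow{\partial}L)):=Z^2/\!\sim$, $\pi^2(C^*(\Pi,M\xrightarrow{\partial}L)):=Z^2/\!\simeq$. *)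

theory Defs
  imports "HOL-Algebra.Coset" "HOL-Algebra.Bij" "HOL-Library.Equipollence"
begin

text \<open>
  All groups, including the (not necessarily abelian) group \<open>M\<close>, are written multiplicatively,
  as records of HOL-Algebra. An action of \<open>L\<close> on \<open>M\<close> by automorphisms is a homomorphism
  \<open>\<rho> : L \<rightarrow> AutoGroup M\<close>; the element \<open>xm\<close> is \<open>\<rho> x m\<close>.
\<close>

locale crossed_module = M: group M + L: group L
  for M :: "('m, 'mm) monoid_scheme" and L :: "('l, 'll) monoid_scheme" +
  fixes d :: "'m \<Rightarrow> 'l" and \<rho> :: "'l \<Rightarrow> 'm \<Rightarrow> 'm"
  assumes boundary_hom: "d \<in> hom M L"
    and action_hom: "\<rho> \<in> hom L (AutoGroup M)"
    and equivariance: "\<And>x m. x \<in> carrier L \<Longrightarrow> m \<in> carrier M \<Longrightarrow>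
          d (\<rho> x m) = x \<otimes>\<^bsub>L\<^esub> d m \<otimes>\<^bsub>L\<^esub> inv\<^bsub>L\<^esub> x"
    and peiffer: "\<And>n m. n \<in> carrier M \<Longrightarrow> m \<in> carrier M \<Longrightarrow>
          \<rho> (d n) m = n \<otimes>\<^bsub>M\<^esub> m \<otimes>\<^bsub>M\<^esub> inv\<^bsub>M\<^esub> n"


section \<open>Extensions of the type of a crossed module\<close>

text \<open>
  An extension is a tuple \<open>(B, \<kappa>, \<sigma>, r)\<close>, where \<open>r : B \<rightarrow> L\<close> is the structure homomorphism.
  The library constant \<open>short_exact_sequence\<close> needs the three groups to have the same
  element type, so the exactness conditions are spelled out with \<open>mon\<close>, \<open>epi\<close> and \<open>kernel\<close>.
\<close>

type_synonym ('m, 'l, 'p, 'b) ext = "'b monoid \<times> ('m \<Rightarrow> 'b) \<times> ('b \<Rightarrow> 'p) \<times> ('b \<Rightarrow> 'l)"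

definition extensions ::
    "('m, 'mm) monoid_scheme \<Rightarrow> ('l, 'll) monoid_scheme \<Rightarrow> ('m \<Rightarrow> 'l) \<Rightarrow> ('l \<Rightarrow> 'm \<Rightarrow> 'm) \<Rightarrow>
     ('p, 'pp) monoid_scheme \<Rightarrow> ('m, 'l, 'p, 'b) ext set" where
  "extensions M L d \<rho> P = {(B, \<kappa>, \<sigma>, r).
     group B \<and> \<kappa> \<in> mon M B \<and> \<sigma> \<in> epi B P \<and> kernel B P \<sigma> = \<kappa> ` carrier M \<and>
     r \<in> hom B L \<and> (\<forall>m \<in> carrier M. r (\<kappa> m) = d m) \<and>
     (\<forall>b \<in> carrier B. \<forall>m \<in> carrier M. b \<otimes>\<^bsub>B\<^esub> \<kappa> m \<otimes>\<^bsub>B\<^esub> inv\<^bsub>B\<^esub> b = \<kappa> (\<rho> (r b) m))}"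

definition congruence ::
    "('m, 'mm) monoid_scheme \<Rightarrow> ('l, 'll) monoid_scheme \<Rightarrow> ('m \<Rightarrow> 'l) \<Rightarrow> ('l \<Rightarrow> 'm \<Rightarrow> 'm) \<Rightarrow>
     ('p, 'pp) monoid_scheme \<Rightarrow> ('m, 'l, 'p, 'b) ext rel" where
  "congruence M L d \<rho> P = {((B, \<kappa>, \<sigma>, r), (B', \<kappa>', \<sigma>', r')).
     (B, \<kappa>, \<sigma>, r) \<in> extensions M L d \<rho> P \<and> (B', \<kappa>', \<sigma>', r') \<in> extensions M L d \<rho> P \<and>
     (\<exists>\<alpha> \<in> hom B B'.
        (\<forall>m \<in> carrier M. \<alpha> (\<kappa> m) = \<kappa>' m) \<and>
        (\<forall>b \<in> carrier B. \<sigma>' (\<alpha> b) = \<sigma> b) \<and>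
        (\<forall>b \<in> carrier B. r' (\<alpha> b) = r b))}"

definition weak_congruence ::
    "('m, 'mm) monoid_scheme \<Rightarrow> ('l, 'll) monoid_scheme \<Rightarrow> ('m \<Rightarrow> 'l) \<Rightarrow> ('l \<Rightarrow> 'm \<Rightarrow> 'm) \<Rightarrow>
     ('p, 'pp) monoid_scheme \<Rightarrow> ('m, 'l, 'p, 'b) ext rel" where
  "weak_congruence M L d \<rho> P = {((B, \<kappa>, \<sigma>, r), (B', \<kappa>', \<sigma>', r')).
     (B, \<kappa>, \<sigma>, r) \<in> extensions M L d \<rho> P \<and> (B', \<kappa>', \<sigma>', r') \<in> extensions M L d \<rho> P \<and>
     (\<exists>\<alpha> \<in> iso B B'. \<exists>\<tau> \<in> carrier L.
        (\<forall>m \<in> carrier M. \<alpha> (\<kappa> m) = \<kappa>' (\<rho> \<tau> m)) \<and>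
        (\<forall>b \<in> carrier B. \<sigma>' (\<alpha> b) = \<sigma> b) \<and>
        (\<forall>b \<in> carrier B. inv\<^bsub>L\<^esub> \<tau> \<otimes>\<^bsub>L\<^esub> r' (\<alpha> b) \<otimes>\<^bsub>L\<^esub> \<tau> = r b))}"

text \<open>
  Here the middle groups have carriers in the type \<open>'b\<close>, which has to be large enough
  for these sets to contain every extension up to congruence. Since the middle group of an extension is
  in bijection with \<open>M \<times> P\<close>, this means \<open>carrier M \<times> carrier P \<lesssim> (UNIV :: 'b set)\<close>.
\<close>

definition Ext ::
    "('m, 'mm) monoid_scheme \<Rightarrow> ('l, 'll) monoid_scheme \<Rightarrow> ('m \<Rightarrow> 'l) \<Rightarrow> ('l \<Rightarrow> 'm \<Rightarrow> 'm) \<Rightarrow>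
     ('p, 'pp) monoid_scheme \<Rightarrow> ('m, 'l, 'p, 'b) ext set set" where
  "Ext M L d \<rho> P = extensions M L d \<rho> P // congruence M L d \<rho> P"

definition wExt ::
    "('m, 'mm) monoid_scheme \<Rightarrow> ('l, 'll) monoid_scheme \<Rightarrow> ('m \<Rightarrow> 'l) \<Rightarrow> ('l \<Rightarrow> 'm \<Rightarrow> 'm) \<Rightarrow>
     ('p, 'pp) monoid_scheme \<Rightarrow> ('m, 'l, 'p, 'b) ext set set" where
  "wExt M L d \<rho> P = extensions M L d \<rho> P // weak_congruence M L d \<rho> P"


section \<open>Non-abelian 2-cocycles\<close>

type_synonym ('m, 'l, 'p) cochain = "('p \<times> 'p \<Rightarrow> 'm) \<times> ('p \<Rightarrow> 'l)"

definition cocycles ::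
    "('m, 'mm) monoid_scheme \<Rightarrow> ('l, 'll) monoid_scheme \<Rightarrow> ('m \<Rightarrow> 'l) \<Rightarrow> ('l \<Rightarrow> 'm \<Rightarrow> 'm) \<Rightarrow>
     ('p, 'pp) monoid_scheme \<Rightarrow> ('m, 'l, 'p) cochain set" where
  "cocycles M L d \<rho> P = {(f, \<phi>).
     f \<in> carrier P \<times> carrier P \<rightarrow>\<^sub>E carrier M \<and> \<phi> \<in> carrier P \<rightarrow>\<^sub>E carrier L \<and>
     (\<forall>x \<in> carrier P. \<forall>y \<in> carrier P.
        \<phi> (x \<otimes>\<^bsub>P\<^esub> y) = d (f (x, y)) \<otimes>\<^bsub>L\<^esub> \<phi> x \<otimes>\<^bsub>L\<^esub> \<phi> y) \<and>
     (\<forall>x \<in> carrier P. \<forall>y \<in> carrier P. \<forall>z \<in> carrier P.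
        f (x \<otimes>\<^bsub>P\<^esub> y, z) \<otimes>\<^bsub>M\<^esub> f (x, y) = f (x, y \<otimes>\<^bsub>P\<^esub> z) \<otimes>\<^bsub>M\<^esub> \<rho> (\<phi> x) (f (y, z)))}"

text \<open>
  In both relations the pairs are ordered as \<open>((f', \<phi>'), (f, \<phi>))\<close>.
\<close>

definition cohomologous ::
    "('m, 'mm) monoid_scheme \<Rightarrow> ('l, 'll) monoid_scheme \<Rightarrow> ('m \<Rightarrow> 'l) \<Rightarrow> ('l \<Rightarrow> 'm \<Rightarrow> 'm) \<Rightarrow>
     ('p, 'pp) monoid_scheme \<Rightarrow> ('m, 'l, 'p) cochain rel" where
  "cohomologous M L d \<rho> P = {((f', \<phi>'), (f, \<phi>)).
     (f', \<phi>') \<in> cocycles M L d \<rho> P \<and> (f, \<phi>) \<in> cocycles M L d \<rho> P \<and>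
     (\<exists>t \<in> carrier P \<rightarrow> carrier M.
        (\<forall>x \<in> carrier P. \<forall>y \<in> carrier P.
           f' (x, y) = inv\<^bsub>M\<^esub> t (x \<otimes>\<^bsub>P\<^esub> y) \<otimes>\<^bsub>M\<^esub> f (x, y) \<otimes>\<^bsub>M\<^esub> t x \<otimes>\<^bsub>M\<^esub> \<rho> (\<phi>' x) (t y)) \<and>
        (\<forall>x \<in> carrier P. \<phi> x = d (t x) \<otimes>\<^bsub>L\<^esub> \<phi>' x))}"

definition weakly_cohomologous ::
    "('m, 'mm) monoid_scheme \<Rightarrow> ('l, 'll) monoid_scheme \<Rightarrow> ('m \<Rightarrow> 'l) \<Rightarrow> ('l \<Rightarrow> 'm \<Rightarrow> 'm) \<Rightarrow>
     ('p, 'pp) monoid_scheme \<Rightarrow> ('m, 'l, 'p) cochain rel" where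
  "weakly_cohomologous M L d \<rho> P = {((f', \<phi>'), (f, \<phi>)).
     (f', \<phi>') \<in> cocycles M L d \<rho> P \<and> (f, \<phi>) \<in> cocycles M L d \<rho> P \<and>
     (\<exists>t \<in> carrier P \<rightarrow> carrier M. \<exists>\<tau> \<in> carrier L.
        (\<forall>x \<in> carrier P. \<forall>y \<in> carrier P.
           f' (x, y) =
             inv\<^bsub>M\<^esub> t (x \<otimes>\<^bsub>P\<^esub> y) \<otimes>\<^bsub>M\<^esub> \<rho> \<tau> (f (x, y)) \<otimes>\<^bsub>M\<^esub> t x \<otimes>\<^bsub>M\<^esub> \<rho> (\<phi>' x) (t y)) \<and>
        (\<forall>x \<in> carrier P. \<phi> x = inv\<^bsub>L\<^esub> \<tau> \<otimes>\<^bsub>L\<^esub> d (t x) \<otimes>\<^bsub>L\<^esub> \<phi>' x \<otimes>\<^bsub>L\<^esub> \<tau>))}"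

text \<open>\<open>pi2_hat\<close> and \<open>pi2\<close> are \<open>Z\<^sup>2\<close> modulo the stronger and the weaker relation, respectively.\<close>

definition pi2_hat ::
    "('m, 'mm) monoid_scheme \<Rightarrow> ('l, 'll) monoid_scheme \<Rightarrow> ('m \<Rightarrow> 'l) \<Rightarrow> ('l \<Rightarrow> 'm \<Rightarrow> 'm) \<Rightarrow>
     ('p, 'pp) monoid_scheme \<Rightarrow> ('m, 'l, 'p) cochain set set" where
  "pi2_hat M L d \<rho> P = cocycles M L d \<rho> P // cohomologous M L d \<rho> P"

definition pi2 ::
    "('m, 'mm) monoid_scheme \<Rightarrow> ('l, 'll) monoid_scheme \<Rightarrow> ('m \<Rightarrow> 'l) \<Rightarrow> ('l \<Rightarrow> 'm \<Rightarrow> 'm) \<Rightarrow>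
     ('p, 'pp) monoid_scheme \<Rightarrow> ('m, 'l, 'p) cochain set set" where
  "pi2 M L d \<rho> P = cocycles M L d \<rho> P // weakly_cohomologous M L d \<rho> P"

end

theory Submission
  imports Defs
begin

text \<open>
  A set-theoretic section \<open>s\<close> of an extension \<open>(B, \<kappa>, \<sigma>, r)\<close> determines a cocycle by \<open>\<phi> x = r (s x)\<close>
  and \<open>s (x y) = \<kappa> (f(x, y)) s x s y\<close>, and \<open>b = \<kappa> m s x\<close> gives coordinates on \<open>B\<close> in which the
  multiplication is expressed through \<open>f\<close> and \<open>\<phi>\<close> alone; hence every cocycle arises from the
  correspondingly twisted product on \<open>M \<times> P\<close>. If \<open>E\<close> and \<open>E'\<close> have the cocycles \<open>(f, \<phi>)\<close> and
  \<open>(f', \<phi>')\<close> for sections \<open>s\<close> and \<open>s'\<close>, the equation \<open>\<alpha> (s x) = \<kappa>' (t x) s' x\<close> makes morphisms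
  \<open>\<alpha> : E \<rightarrow> E'\<close> over \<open>\<tau>\<close> correspond to cochains \<open>t\<close> relating \<open>(f', \<phi>')\<close> to \<open>(f, \<phi>)\<close> over \<open>\<tau>\<close>.
\<close>

section \<open>Bijections of quotients induced by many-valued correspondences\<close>

lemma bij_betw_quotients_of_correspondence:
  assumes r: "equiv A r" and q: "q \<subseteq> C \<times> C"
    and dom: "\<And>a c. R a c \<Longrightarrow> a \<in> A \<and> c \<in> C"
    and left: "\<And>a. a \<in> A \<Longrightarrow> \<exists>c. R a c"
    and right: "\<And>c. c \<in> C \<Longrightarrow> \<exists>a. R a c"
    and iff: "\<And>a c a' c'. R a c \<Longrightarrow> R a' c' \<Longrightarrow> (a, a') \<in> r \<longleftrightarrow> (c', c) \<in> q"
  shows "\<exists>h. bij_betw h (A // r) (C // q)"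
proof -
  have symr: "(a, b) \<in> r \<Longrightarrow> (b, a) \<in> r" and reflr: "a \<in> A \<Longrightarrow> (a, a) \<in> r" for a b
    using r by (auto simp: equiv_def sym_def refl_on_def)
  \<comment> \<open>\<open>R\<close> is many-valued, since an extension has many sections and a
    cocycle comes from many extensions; so \<open>h\<close> collects all partners of all members of
    a class.\<close>
  define h where "h X = {c. \<exists>a\<in>X. R a c}" for X
  \<comment> \<open>A single partner \<open>c\<close> already determines the image class. The
    symmetry of \<open>r\<close> compensates for the reversed order of the pairs in
    \<open>iff\<close>.\<close>
  have h: "h (r `` {a}) = q `` {c}" if ac: "R a c" for a c
  proof (intro equalityI subsetI)
    fix c' assume "c' \<in> h (r `` {a})"
    then show "c' \<in> q `` {c}" using ac iff symr unfolding h_def by blast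
  next
    fix c' assume c': "c' \<in> q `` {c}"
    then obtain a' where "R a' c'" using q right by blast
    then show "c' \<in> h (r `` {a})" using ac iff symr c' unfolding h_def by blast
  qed
  have "bij_betw h (A // r) (C // q)"
    unfolding bij_betw_def
  proof
    show "inj_on h (A // r)"
    proof (rule inj_onI)
      fix X Y assume "X \<in> A // r" "Y \<in> A // r" and eq: "h X = h Y"
      then obtain a b where ab: "a \<in> A" "b \<in> A" "X = r `` {a}" "Y = r `` {b}"
        by (auto elim!: quotientE)
      then obtain c e where ce: "R a c" "R b e" using left by blast
      \<comment> \<open>That \<open>q\<close> is an equivalence is not assumed: what is needed of it
        is inherited from \<open>r\<close> through \<open>R\<close>, here reflexivity at
        \<open>c\<close>.\<close>
      have "(c, c) \<in> q" using iff[OF ce(1) ce(1)] reflr ab by blast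
      then have "(e, c) \<in> q" using h[OF ce(1)] h[OF ce(2)] eq ab by blast
      then have "(a, b) \<in> r" using iff[OF ce] by blast
      then show "X = Y" using ab equiv_class_eq[OF r] by blast
    qed
    show "h ` (A // r) = C // q"
    proof (intro equalityI subsetI)
      fix Z assume "Z \<in> h ` (A // r)"
      then obtain a where a: "a \<in> A" "Z = h (r `` {a})" by (auto elim!: quotientE)
      then obtain c where "R a c" using left by blast
      then show "Z \<in> C // q" using h a dom by (auto intro: quotientI)
    next
      fix Z assume "Z \<in> C // q"
      then obtain c where c: "c \<in> C" "Z = q `` {c}" by (auto elim!: quotientE)
      then obtain a where "R a c" using right by blast
      then have "Z = h (r `` {a})" and "r `` {a} \<in> A // r"
        using h c dom by (auto intro: quotientI)
      then show "Z \<in> h ` (A // r)" by blast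
    qed
  qed
  then show ?thesis by blast
qed

section \<open>Calculation rules for the action of a crossed module\<close>

context crossed_module
begin

sublocale d: group_hom M L d
  using boundary_hom by unfold_locales

lemma action_auto: "x \<in> carrier L \<Longrightarrow> \<rho> x \<in> auto M"
  using action_hom by (auto simp: hom_def AutoGroup_def)

lemma action_Bij: "x \<in> carrier L \<Longrightarrow> \<rho> x \<in> Bij (carrier M)"
  using action_auto by (auto simp: auto_def)

lemma action_closed [simp]: "x \<in> carrier L \<Longrightarrow> m \<in> carrier M \<Longrightarrow> \<rho> x m \<in> carrier M"
  using action_auto by (auto simp: auto_def hom_def)

lemma action_mult [simp]:
  "x \<in> carrier L \<Longrightarrow> m \<in> carrier M \<Longrightarrow> n \<in> carrier M \<Longrightarrow> \<rho> x (m \<otimes>\<^bsub>M\<^esub> n) = \<rho> x m \<otimes>\<^bsub>M\<^esub> \<rho> x n"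
  using action_auto by (auto simp: auto_def hom_def)

lemma action_comp:
  assumes "x \<in> carrier L" "y \<in> carrier L" "m \<in> carrier M"
  shows "\<rho> (x \<otimes>\<^bsub>L\<^esub> y) m = \<rho> x (\<rho> y m)"
proof -
  \<comment> \<open>Multiplication in \<open>AutoGroup M\<close> is
    \<open>compose (carrier M)\<close>, which is plain composition on the carrier.\<close>
  have "\<rho> (x \<otimes>\<^bsub>L\<^esub> y) = compose (carrier M) (\<rho> x) (\<rho> y)"
    using hom_mult[OF action_hom assms(1,2)] action_Bij[OF assms(1)] action_Bij[OF assms(2)]
    by (simp add: AutoGroup_def BijGroup_def)
  then show ?thesis
    using assms(3) by (simp add: compose_eq)
qed

lemma action_group_hom: "x \<in> carrier L \<Longrightarrow> group_hom M M (\<rho> x)"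
  using action_auto by unfold_locales (auto simp: auto_def)

lemma action_inv [simp]:
  "x \<in> carrier L \<Longrightarrow> m \<in> carrier M \<Longrightarrow> \<rho> x (inv\<^bsub>M\<^esub> m) = inv\<^bsub>M\<^esub> \<rho> x m"
  by (simp add: action_group_hom group_hom.hom_inv)

lemma action_one [simp]: "x \<in> carrier L \<Longrightarrow> \<rho> x \<one>\<^bsub>M\<^esub> = \<one>\<^bsub>M\<^esub>"
  by (simp add: action_group_hom group_hom.hom_one)

lemma one_action [simp]:
  assumes "m \<in> carrier M" shows "\<rho> \<one>\<^bsub>L\<^esub> m = m"
  using peiffer[of "\<one>\<^bsub>M\<^esub>" m] assms by simp

lemma action_inv_action [simp]:
  "x \<in> carrier L \<Longrightarrow> m \<in> carrier M \<Longrightarrow> \<rho> x (\<rho> (inv\<^bsub>L\<^esub> x) m) = m"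
  "x \<in> carrier L \<Longrightarrow> m \<in> carrier M \<Longrightarrow> \<rho> (inv\<^bsub>L\<^esub> x) (\<rho> x m) = m"
  by (simp_all flip: action_comp)

end

text \<open>Rewriting with \<open>m_assoc\<close> nests products to the right and hides adjacent
  inverse pairs from \<open>l_inv\<close> and \<open>r_inv\<close>; these rules cancel them in
  nested form.\<close>

lemma (in group) mult_inv_cancel [simp]:
  assumes "x \<in> carrier G" "y \<in> carrier G"
  shows "inv x \<otimes> (x \<otimes> y) = y" "x \<otimes> (inv x \<otimes> y) = y"
  using assms by (simp_all flip: m_assoc)

section \<open>Extensions and their fibres\<close>

locale extension = crossed_module M L d \<rho> + P: group P + B: group B
  for M :: "('m, 'mm) monoid_scheme" and L :: "('l, 'll) monoid_scheme" and d \<rho>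
    and P :: "('p, 'pp) monoid_scheme" and B :: "'b monoid" +
  fixes \<kappa> :: "'m \<Rightarrow> 'b" and \<sigma> :: "'b \<Rightarrow> 'p" and r :: "'b \<Rightarrow> 'l"
  assumes kappa_mon: "\<kappa> \<in> mon M B"
    and sigma_epi: "\<sigma> \<in> epi B P"
    and exact: "kernel B P \<sigma> = \<kappa> ` carrier M"
    and r_hom: "r \<in> hom B L"
    and r_kappa [simp]: "m \<in> carrier M \<Longrightarrow> r (\<kappa> m) = d m"
    and conj_kappa: "b \<in> carrier B \<Longrightarrow> m \<in> carrier M \<Longrightarrow>
          b \<otimes>\<^bsub>B\<^esub> \<kappa> m \<otimes>\<^bsub>B\<^esub> inv\<^bsub>B\<^esub> b = \<kappa> (\<rho> (r b) m)"
begin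

sublocale \<kappa>: group_hom M B \<kappa>
  using kappa_mon by unfold_locales (auto simp: mon_def)

sublocale \<sigma>: group_hom B P \<sigma>
  using sigma_epi by unfold_locales (auto simp: epi_def)

sublocale r: group_hom B L r
  using r_hom by unfold_locales

lemma kappa_eq_iff [simp]: "m \<in> carrier M \<Longrightarrow> n \<in> carrier M \<Longrightarrow> \<kappa> m = \<kappa> n \<longleftrightarrow> m = n"
  using kappa_mon inj_on_eq_iff unfolding mon_def by fastforce

lemma sigma_kappa [simp]: "m \<in> carrier M \<Longrightarrow> \<sigma> (\<kappa> m) = \<one>\<^bsub>P\<^esub>"
  using exact unfolding kernel_def by blast

text \<open>The conjugation law multiplied by \<open>b\<close> on the right. In this form it moves
  elements of \<open>M\<close> to the left, towards the normal form
  \<open>\<kappa> m \<otimes> s x\<close>.\<close>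

lemma kappa_swap:
  assumes "b \<in> carrier B" "m \<in> carrier M"
  shows "b \<otimes>\<^bsub>B\<^esub> \<kappa> m = \<kappa> (\<rho> (r b) m) \<otimes>\<^bsub>B\<^esub> b"
  using assms conj_kappa[of b m] B.inv_solve_right'[of "\<kappa> (\<rho> (r b) m)" "b \<otimes>\<^bsub>B\<^esub> \<kappa> m" b] by simp

text \<open>The quotient \<open>b \<otimes> inv c\<close> lies in the kernel of
  \<open>\<sigma>\<close>, hence in the image of \<open>\<kappa>\<close>. Factor sets, coordinates
  and the cochains \<open>t\<close> are all obtained from this.\<close>

lemma same_fibre:
  assumes "b \<in> carrier B" "c \<in> carrier B" "\<sigma> b = \<sigma> c"
  obtains m where "m \<in> carrier M" "b = \<kappa> m \<otimes>\<^bsub>B\<^esub> c"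
proof -
  have "b \<otimes>\<^bsub>B\<^esub> inv\<^bsub>B\<^esub> c \<in> kernel B P \<sigma>"
    using assms by (simp add: kernel_def)
  then obtain m where "m \<in> carrier M" "b \<otimes>\<^bsub>B\<^esub> inv\<^bsub>B\<^esub> c = \<kappa> m"
    unfolding exact by auto
  moreover from this have "b = \<kappa> m \<otimes>\<^bsub>B\<^esub> c"
    using assms B.inv_solve_right'[of "\<kappa> m" b c] by simp
  ultimately show thesis using that by blast
qed

lemma sigma_surj:
  assumes "x \<in> carrier P"
  obtains b where "b \<in> carrier B" "\<sigma> b = x"
proof -
  have "x \<in> \<sigma> ` carrier B" using sigma_epi assms by (simp add: epi_def)
  then show thesis using that by blast
qed

end

text \<open>Passage from tuples to the locale, so that members of \<open>extensions\<close> can be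
  interpreted.\<close>

lemma (in crossed_module) mem_extensions_iff:
  assumes "group P"
  shows "(B, \<kappa>, \<sigma>, r) \<in> extensions M L d \<rho> P \<longleftrightarrow> extension M L d \<rho> P B \<kappa> \<sigma> r"
  unfolding extensions_def extension_def extension_axioms_def
  by (simp add: assms crossed_module_axioms) blast

section \<open>Sections, their factor sets and coordinates on the middle group\<close>

locale factor_set = extension M L d \<rho> P B \<kappa> \<sigma> r
  for M :: "('m, 'mm) monoid_scheme" and L :: "('l, 'll) monoid_scheme" and d \<rho>
    and P :: "('p, 'pp) monoid_scheme" and B :: "'b monoid" and \<kappa> \<sigma> r +
  fixes s :: "'p \<Rightarrow> 'b" and f :: "'p \<times> 'p \<Rightarrow> 'm" and \<phi> :: "'p \<Rightarrow> 'l"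
  assumes s_closed [simp]: "x \<in> carrier P \<Longrightarrow> s x \<in> carrier B"
    and sigma_s [simp]: "x \<in> carrier P \<Longrightarrow> \<sigma> (s x) = x"
    and f_closed [simp]: "x \<in> carrier P \<Longrightarrow> y \<in> carrier P \<Longrightarrow> f (x, y) \<in> carrier M"
    and r_s [simp]: "x \<in> carrier P \<Longrightarrow> r (s x) = \<phi> x"
    and s_mult: "x \<in> carrier P \<Longrightarrow> y \<in> carrier P \<Longrightarrow>
          s (x \<otimes>\<^bsub>P\<^esub> y) = \<kappa> (f (x, y)) \<otimes>\<^bsub>B\<^esub> (s x \<otimes>\<^bsub>B\<^esub> s y)"
begin

lemma phi_closed [simp]: "x \<in> carrier P \<Longrightarrow> \<phi> x \<in> carrier L"
  using r.hom_closed[of "s x"] by simp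

text \<open>The image of \<open>s_mult\<close> under \<open>r\<close>, which restricts to
  \<open>d\<close> along \<open>\<kappa>\<close>.\<close>

lemma phi_mult:
  assumes "x \<in> carrier P" "y \<in> carrier P"
  shows "\<phi> (x \<otimes>\<^bsub>P\<^esub> y) = d (f (x, y)) \<otimes>\<^bsub>L\<^esub> \<phi> x \<otimes>\<^bsub>L\<^esub> \<phi> y"
  using assms arg_cong[OF s_mult, of x y r] by (simp add: L.m_assoc)

lemma s_kappa:
  assumes "x \<in> carrier P" "m \<in> carrier M"
  shows "s x \<otimes>\<^bsub>B\<^esub> \<kappa> m = \<kappa> (\<rho> (\<phi> x) m) \<otimes>\<^bsub>B\<^esub> s x"
  using assms kappa_swap[of "s x" m] by simp

lemma kappa_s_eq_iff [simp]:
  assumes "m \<in> carrier M" "n \<in> carrier M" "x \<in> carrier P"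
  shows "\<kappa> m \<otimes>\<^bsub>B\<^esub> s x = \<kappa> n \<otimes>\<^bsub>B\<^esub> s x \<longleftrightarrow> m = n"
  using assms by simp

text \<open>Move \<open>\<kappa> n\<close> to the left past \<open>s x\<close>, then express
  \<open>s x \<otimes> s y\<close> through \<open>s\<close> of the product. The result is the model
  for the multiplication of \<open>twisted_product\<close>.\<close>

lemma kappa_s_mult:
  assumes [simp]: "m \<in> carrier M" "n \<in> carrier M" "x \<in> carrier P" "y \<in> carrier P"
  shows "(\<kappa> m \<otimes>\<^bsub>B\<^esub> s x) \<otimes>\<^bsub>B\<^esub> (\<kappa> n \<otimes>\<^bsub>B\<^esub> s y) =
    \<kappa> (m \<otimes>\<^bsub>M\<^esub> \<rho> (\<phi> x) n \<otimes>\<^bsub>M\<^esub> inv\<^bsub>M\<^esub> f (x, y)) \<otimes>\<^bsub>B\<^esub> s (x \<otimes>\<^bsub>P\<^esub> y)"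
proof -
  have "(\<kappa> m \<otimes>\<^bsub>B\<^esub> s x) \<otimes>\<^bsub>B\<^esub> (\<kappa> n \<otimes>\<^bsub>B\<^esub> s y) = \<kappa> m \<otimes>\<^bsub>B\<^esub> ((s x \<otimes>\<^bsub>B\<^esub> \<kappa> n) \<otimes>\<^bsub>B\<^esub> s y)"
    by (simp add: B.m_assoc)
  also have "\<dots> = \<kappa> (m \<otimes>\<^bsub>M\<^esub> \<rho> (\<phi> x) n \<otimes>\<^bsub>M\<^esub> inv\<^bsub>M\<^esub> f (x, y)) \<otimes>\<^bsub>B\<^esub> s (x \<otimes>\<^bsub>P\<^esub> y)"
    by (simp add: s_kappa s_mult B.m_assoc)
  finally show ?thesis .
qed

text \<open>Associativity in \<open>P\<close>: expand \<open>s\<close> of a triple product in both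
  bracketings, cancel the common factor \<open>s x \<otimes> (s y \<otimes> s z)\<close> and use
  injectivity of \<open>\<kappa>\<close>.\<close>

lemma factor_identity:
  assumes [simp]: "x \<in> carrier P" "y \<in> carrier P" "z \<in> carrier P"
  shows "f (x \<otimes>\<^bsub>P\<^esub> y, z) \<otimes>\<^bsub>M\<^esub> f (x, y) = f (x, y \<otimes>\<^bsub>P\<^esub> z) \<otimes>\<^bsub>M\<^esub> \<rho> (\<phi> x) (f (y, z))"
proof -
  have "\<kappa> (f (x \<otimes>\<^bsub>P\<^esub> y, z) \<otimes>\<^bsub>M\<^esub> f (x, y)) \<otimes>\<^bsub>B\<^esub> (s x \<otimes>\<^bsub>B\<^esub> (s y \<otimes>\<^bsub>B\<^esub> s z)) = s (x \<otimes>\<^bsub>P\<^esub> y \<otimes>\<^bsub>P\<^esub> z)"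
    by (simp add: s_mult[of "x \<otimes>\<^bsub>P\<^esub> y" z] s_mult[of x y] B.m_assoc)
  also have "\<dots> = s (x \<otimes>\<^bsub>P\<^esub> (y \<otimes>\<^bsub>P\<^esub> z))"
    by (simp add: P.m_assoc)
  also have "\<dots> = \<kappa> (f (x, y \<otimes>\<^bsub>P\<^esub> z)) \<otimes>\<^bsub>B\<^esub> ((s x \<otimes>\<^bsub>B\<^esub> \<kappa> (f (y, z))) \<otimes>\<^bsub>B\<^esub> (s y \<otimes>\<^bsub>B\<^esub> s z))"
    by (simp add: s_mult[of x "y \<otimes>\<^bsub>P\<^esub> z"] s_mult[of y z] B.m_assoc)
  also have "\<dots> = \<kappa> (f (x, y \<otimes>\<^bsub>P\<^esub> z) \<otimes>\<^bsub>M\<^esub> \<rho> (\<phi> x) (f (y, z))) \<otimes>\<^bsub>B\<^esub> (s x \<otimes>\<^bsub>B\<^esub> (s y \<otimes>\<^bsub>B\<^esub> s z))"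
    by (simp add: s_kappa B.m_assoc)
  \<comment> \<open>The images of products under \<open>\<kappa>\<close> have to stay folded for the
    injectivity of \<open>\<kappa>\<close> to apply.\<close>
  finally show ?thesis by (simp del: \<kappa>.hom_mult)
qed

lemma kappa_s_cases:
  assumes "b \<in> carrier B"
  obtains m where "m \<in> carrier M" "b = \<kappa> m \<otimes>\<^bsub>B\<^esub> s (\<sigma> b)"
  using same_fibre[of b "s (\<sigma> b)"] assms by auto

text \<open>Cancel \<open>s \<one>\<close> in \<open>s_mult\<close> at the unit. As \<open>s\<close>
  is not normalized, this gives the coordinates of the unit of \<open>B\<close>.\<close>

lemma kappa_f_one: "\<kappa> (f (\<one>\<^bsub>P\<^esub>, \<one>\<^bsub>P\<^esub>)) \<otimes>\<^bsub>B\<^esub> s \<one>\<^bsub>P\<^esub> = \<one>\<^bsub>B\<^esub>"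
proof -
  have "s \<one>\<^bsub>P\<^esub> = (\<kappa> (f (\<one>\<^bsub>P\<^esub>, \<one>\<^bsub>P\<^esub>)) \<otimes>\<^bsub>B\<^esub> s \<one>\<^bsub>P\<^esub>) \<otimes>\<^bsub>B\<^esub> s \<one>\<^bsub>P\<^esub>"
    using s_mult[of "\<one>\<^bsub>P\<^esub>" "\<one>\<^bsub>P\<^esub>"] by (simp add: B.m_assoc)
  then show ?thesis
    by simp
qed

text \<open>The twisted product lives on pairs, whereas \<open>Ext\<close> admits only middle groups
  over a prescribed type. Transport of structure along an injection changes the group but not the
  cocycle.\<close>

lemma transport:
  fixes \<iota> :: "'b \<Rightarrow> 'c"
  assumes "inj_on \<iota> (carrier B)"
  shows "\<exists>(B' :: 'c monoid) \<kappa>' \<sigma>' r' s'. factor_set M L d \<rho> P B' \<kappa>' \<sigma>' r' s' f \<phi>"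
proof -
  define j where "j = inv_into (carrier B) \<iota>"
  have j [simp]: "j (\<iota> b) = b" if "b \<in> carrier B" for b
    unfolding j_def using assms that by (rule inv_into_f_f)
  define B' where "B' = \<lparr>carrier = \<iota> ` carrier B, mult = (\<lambda>u v. \<iota> (j u \<otimes>\<^bsub>B\<^esub> j v)), one = \<iota> \<one>\<^bsub>B\<^esub>\<rparr>"
  have carrier: "carrier B' = \<iota> ` carrier B" and one: "\<one>\<^bsub>B'\<^esub> = \<iota> \<one>\<^bsub>B\<^esub>"
    by (simp_all add: B'_def)
  have mult [simp]: "\<iota> b \<otimes>\<^bsub>B'\<^esub> \<iota> c = \<iota> (b \<otimes>\<^bsub>B\<^esub> c)" if "b \<in> carrier B" "c \<in> carrier B" for b c
    using that by (simp add: B'_def)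
  have "group B'"
  proof (rule groupI)
    fix u assume "u \<in> carrier B'"
    then obtain b where b: "b \<in> carrier B" "u = \<iota> b" by (auto simp: carrier)
    then have "\<iota> (inv\<^bsub>B\<^esub> b) \<otimes>\<^bsub>B'\<^esub> u = \<one>\<^bsub>B'\<^esub>" by (simp add: one)
    then show "\<exists>v\<in>carrier B'. v \<otimes>\<^bsub>B'\<^esub> u = \<one>\<^bsub>B'\<^esub>"
      using b by (intro bexI[of _ "\<iota> (inv\<^bsub>B\<^esub> b)"]) (auto simp: carrier)
  qed (auto simp: carrier one B.m_assoc)
  then interpret B': group B' .
  have inv [simp]: "inv\<^bsub>B'\<^esub> (\<iota> b) = \<iota> (inv\<^bsub>B\<^esub> b)" if "b \<in> carrier B" for b
    by (rule B'.inv_equality) (use that in \<open>simp_all add: carrier one\<close>)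
  have iota_eq: "\<iota> b = \<iota> c \<longleftrightarrow> b = c" if "b \<in> carrier B" "c \<in> carrier B" for b c
    using that assms by (simp add: inj_on_eq_iff)
  have "factor_set M L d \<rho> P B' (\<iota> \<circ> \<kappa>) (\<sigma> \<circ> j) (r \<circ> j) (\<iota> \<circ> s) f \<phi>"
  proof unfold_locales
    show "\<iota> \<circ> \<kappa> \<in> mon M B'"
      by (auto simp: mon_def hom_def carrier iota_eq inj_on_def)
    show "\<sigma> \<circ> j \<in> epi B' P"
      using sigma_epi by (auto simp: epi_def hom_def carrier image_comp)
    show "kernel B' P (\<sigma> \<circ> j) = (\<iota> \<circ> \<kappa>) ` carrier M"
    proof -
      have "kernel B' P (\<sigma> \<circ> j) = \<iota> ` kernel B P \<sigma>"
        by (auto simp: kernel_def carrier)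
      then show ?thesis by (simp add: exact image_comp)
    qed
    show "r \<circ> j \<in> hom B' L"
      by (auto simp: hom_def carrier)
  qed (auto simp: carrier conj_kappa s_mult)
  then show ?thesis by blast
qed

end

text \<open>Choose a preimage \<open>s x\<close> of every \<open>x\<close>; then
  \<open>s (x \<otimes> y)\<close> and \<open>s x \<otimes> s y\<close> lie in one fibre, and a
  second choice gives \<open>f\<close>.\<close>

lemma (in extension) exists_factor_set:
  "\<exists>s. \<exists>f \<in> carrier P \<times> carrier P \<rightarrow>\<^sub>E carrier M. \<exists>\<phi> \<in> carrier P \<rightarrow>\<^sub>E carrier L.
     factor_set M L d \<rho> P B \<kappa> \<sigma> r s f \<phi>"
proof -
  have "\<forall>x\<in>carrier P. \<exists>b. b \<in> carrier B \<and> \<sigma> b = x"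
    using sigma_surj by metis
  then obtain s where s: "x \<in> carrier P \<Longrightarrow> s x \<in> carrier B" "x \<in> carrier P \<Longrightarrow> \<sigma> (s x) = x" for x
    by metis
  have "\<exists>m. m \<in> carrier M \<and> s (x \<otimes>\<^bsub>P\<^esub> y) = \<kappa> m \<otimes>\<^bsub>B\<^esub> (s x \<otimes>\<^bsub>B\<^esub> s y)"
    if "x \<in> carrier P" "y \<in> carrier P" for x y
    using that same_fibre[of "s (x \<otimes>\<^bsub>P\<^esub> y)" "s x \<otimes>\<^bsub>B\<^esub> s y"] by (auto simp: s)
  then obtain g where g: "g x y \<in> carrier M" "s (x \<otimes>\<^bsub>P\<^esub> y) = \<kappa> (g x y) \<otimes>\<^bsub>B\<^esub> (s x \<otimes>\<^bsub>B\<^esub> s y)"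
    if "x \<in> carrier P" "y \<in> carrier P" for x y
    by metis
  show ?thesis
  proof (intro exI bexI)
    \<comment> \<open>Both maps are restricted to the carriers because \<open>cocycles\<close>
      consists of extensional functions.\<close>
    show "factor_set M L d \<rho> P B \<kappa> \<sigma> r s (\<lambda>(x, y) \<in> carrier P \<times> carrier P. g x y)
            (\<lambda>x \<in> carrier P. r (s x))"
      by unfold_locales (simp_all add: s g)
  qed (auto simp: s g)
qed

section \<open>The extension defined by a cocycle\<close>

locale cocycle = crossed_module M L d \<rho> + P: group P
  for M :: "('m, 'mm) monoid_scheme" and L :: "('l, 'll) monoid_scheme" and d \<rho>
    and P :: "('p, 'pp) monoid_scheme" +
  fixes f :: "'p \<times> 'p \<Rightarrow> 'm" and \<phi> :: "'p \<Rightarrow> 'l"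
  assumes f_closed [simp]: "x \<in> carrier P \<Longrightarrow> y \<in> carrier P \<Longrightarrow> f (x, y) \<in> carrier M"
    and phi_closed [simp]: "x \<in> carrier P \<Longrightarrow> \<phi> x \<in> carrier L"
    and phi_mult: "x \<in> carrier P \<Longrightarrow> y \<in> carrier P \<Longrightarrow>
          \<phi> (x \<otimes>\<^bsub>P\<^esub> y) = d (f (x, y)) \<otimes>\<^bsub>L\<^esub> \<phi> x \<otimes>\<^bsub>L\<^esub> \<phi> y"
    and identity: "x \<in> carrier P \<Longrightarrow> y \<in> carrier P \<Longrightarrow> z \<in> carrier P \<Longrightarrow>
          f (x \<otimes>\<^bsub>P\<^esub> y, z) \<otimes>\<^bsub>M\<^esub> f (x, y) = f (x, y \<otimes>\<^bsub>P\<^esub> z) \<otimes>\<^bsub>M\<^esub> \<rho> (\<phi> x) (f (y, z))"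
begin

abbreviation f1 where "f1 \<equiv> f (\<one>\<^bsub>P\<^esub>, \<one>\<^bsub>P\<^esub>)"

text \<open>Cancel the last factor \<open>\<phi> \<one>\<close> in the cocycle condition at the
  unit; the rest says that \<open>d f1\<close> and \<open>\<phi> \<one>\<close> are inverse to each
  other.\<close>

lemma phi_one: "\<phi> \<one>\<^bsub>P\<^esub> = inv\<^bsub>L\<^esub> d f1"
proof -
  have "\<phi> \<one>\<^bsub>P\<^esub> = (d f1 \<otimes>\<^bsub>L\<^esub> \<phi> \<one>\<^bsub>P\<^esub>) \<otimes>\<^bsub>L\<^esub> \<phi> \<one>\<^bsub>P\<^esub>"
    using phi_mult[of "\<one>\<^bsub>P\<^esub>" "\<one>\<^bsub>P\<^esub>"] by simp
  then have "d f1 \<otimes>\<^bsub>L\<^esub> \<phi> \<one>\<^bsub>P\<^esub> = \<one>\<^bsub>L\<^esub>"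
    by simp
  then have "\<phi> \<one>\<^bsub>P\<^esub> \<otimes>\<^bsub>L\<^esub> d f1 = \<one>\<^bsub>L\<^esub>"
    by (rule L.inv_comm) simp_all
  then show ?thesis
    using L.inv_equality[of "\<phi> \<one>\<^bsub>P\<^esub>" "d f1"] by simp
qed

text \<open>\<open>\<phi> \<one>\<close> is the boundary of \<open>inv f1\<close>, so by the Peiffer
  identity it acts by conjugation.\<close>

lemma phi_one_action:
  assumes "m \<in> carrier M"
  shows "\<rho> (\<phi> \<one>\<^bsub>P\<^esub>) m = inv\<^bsub>M\<^esub> f1 \<otimes>\<^bsub>M\<^esub> (m \<otimes>\<^bsub>M\<^esub> f1)"
  using assms peiffer[of "inv\<^bsub>M\<^esub> f1" m] by (simp add: phi_one M.m_assoc)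

text \<open>Take the identity at \<open>(\<one>, \<one>, z)\<close>, cancel
  \<open>f (\<one>, z)\<close> on the left and undo the conjugation by \<open>f1\<close>.\<close>

lemma f_one_left:
  assumes [simp]: "z \<in> carrier P" shows "f (\<one>\<^bsub>P\<^esub>, z) = f1"
proof -
  have "f (\<one>\<^bsub>P\<^esub>, z) \<otimes>\<^bsub>M\<^esub> f1 = f (\<one>\<^bsub>P\<^esub>, z) \<otimes>\<^bsub>M\<^esub> \<rho> (\<phi> \<one>\<^bsub>P\<^esub>) (f (\<one>\<^bsub>P\<^esub>, z))"
    using identity[of "\<one>\<^bsub>P\<^esub>" "\<one>\<^bsub>P\<^esub>" z] by (simp only: P.one_closed P.l_one assms)
  then have "\<rho> (\<phi> \<one>\<^bsub>P\<^esub>) (f (\<one>\<^bsub>P\<^esub>, z)) = f1"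
    by simp
  then have "f (\<one>\<^bsub>P\<^esub>, z) \<otimes>\<^bsub>M\<^esub> f1 = f1 \<otimes>\<^bsub>M\<^esub> f1"
    using M.inv_solve_left'[of f1 f1 "f (\<one>\<^bsub>P\<^esub>, z) \<otimes>\<^bsub>M\<^esub> f1"] by (simp add: phi_one_action)
  then show ?thesis by simp
qed

text \<open>The identity at \<open>(x, \<one>, \<one>)\<close> with \<open>f (x, \<one>)\<close>
  cancelled on the left.\<close>

lemma f_one_right:
  assumes [simp]: "x \<in> carrier P" shows "f (x, \<one>\<^bsub>P\<^esub>) = \<rho> (\<phi> x) f1"
  using identity[of x "\<one>\<^bsub>P\<^esub>" "\<one>\<^bsub>P\<^esub>"] by simp

text \<open>\<open>\<phi>\<close> is multiplicative up to the boundary of \<open>f (x, y)\<close>,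
  which acts by conjugation with \<open>f (x, y)\<close>.\<close>

lemma phi_mult_action:
  assumes [simp]: "x \<in> carrier P" "y \<in> carrier P" "m \<in> carrier M"
  shows "\<rho> (\<phi> (x \<otimes>\<^bsub>P\<^esub> y)) m =
    f (x, y) \<otimes>\<^bsub>M\<^esub> (\<rho> (\<phi> x) (\<rho> (\<phi> y) m) \<otimes>\<^bsub>M\<^esub> inv\<^bsub>M\<^esub> f (x, y))"
  by (simp add: phi_mult action_comp peiffer M.m_assoc)

text \<open>Values of \<open>f\<close> enter the twisted multiplication inverted; this is the form
  of the identity needed for associativity.\<close>

lemma identity_inv:
  assumes [simp]: "x \<in> carrier P" "y \<in> carrier P" "z \<in> carrier P"
  shows "inv\<^bsub>M\<^esub> f (x, y) \<otimes>\<^bsub>M\<^esub> inv\<^bsub>M\<^esub> f (x \<otimes>\<^bsub>P\<^esub> y, z) =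
    inv\<^bsub>M\<^esub> \<rho> (\<phi> x) (f (y, z)) \<otimes>\<^bsub>M\<^esub> inv\<^bsub>M\<^esub> f (x, y \<otimes>\<^bsub>P\<^esub> z)"
  using arg_cong[OF identity[OF assms], of "m_inv M"] by (simp add: M.inv_mult_group)

text \<open>
  The pair \<open>(m, x)\<close> stands for \<open>\<kappa> m \<otimes> s x\<close>, and \<open>f\<close> is not normalized: \<open>s \<one>\<close> is the image
  of \<open>inv f(\<one>, \<one>)\<close>.
\<close>

definition twisted_product :: "('m \<times> 'p) monoid" where
  "twisted_product = \<lparr>carrier = carrier M \<times> carrier P,
     mult = (\<lambda>(m, x) (n, y). (m \<otimes>\<^bsub>M\<^esub> (\<rho> (\<phi> x) n \<otimes>\<^bsub>M\<^esub> inv\<^bsub>M\<^esub> f (x, y)), x \<otimes>\<^bsub>P\<^esub> y)),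
     one = (f1, \<one>\<^bsub>P\<^esub>)\<rparr>"

lemma twisted_product_simps [simp]:
  "carrier twisted_product = carrier M \<times> carrier P"
  "(m, x) \<otimes>\<^bsub>twisted_product\<^esub> (n, y) = (m \<otimes>\<^bsub>M\<^esub> (\<rho> (\<phi> x) n \<otimes>\<^bsub>M\<^esub> inv\<^bsub>M\<^esub> f (x, y)), x \<otimes>\<^bsub>P\<^esub> y)"
  "\<one>\<^bsub>twisted_product\<^esub> = (f1, \<one>\<^bsub>P\<^esub>)"
  by (simp_all add: twisted_product_def)

text \<open>Associativity combines the cocycle identity with the failure of \<open>\<phi>\<close> to
  be multiplicative; the two conjugating factors cancel.\<close>

lemma group_twisted_product: "group twisted_product"
proof (rule groupI)
  fix u v w assume "u \<in> carrier twisted_product" "v \<in> carrier twisted_product" "w \<in> carrier twisted_product"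
  then obtain m x n y p z where [simp]: "u = (m, x)" "v = (n, y)" "w = (p, z)"
    "m \<in> carrier M" "n \<in> carrier M" "p \<in> carrier M" "x \<in> carrier P" "y \<in> carrier P" "z \<in> carrier P"
    by auto
  show "u \<otimes>\<^bsub>twisted_product\<^esub> v \<otimes>\<^bsub>twisted_product\<^esub> w = u \<otimes>\<^bsub>twisted_product\<^esub> (v \<otimes>\<^bsub>twisted_product\<^esub> w)"
    by (simp add: phi_mult_action M.m_assoc P.m_assoc identity_inv)
next
  fix u assume "u \<in> carrier twisted_product"
  then obtain m x where [simp]: "u = (m, x)" "m \<in> carrier M" "x \<in> carrier P" by auto
  \<comment> \<open>The second coordinate must be \<open>inv x\<close>; the first is then found by
    solving \<open>v \<otimes> u = (f1, \<one>)\<close> for it.\<close>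
  show "\<exists>v\<in>carrier twisted_product. v \<otimes>\<^bsub>twisted_product\<^esub> u = \<one>\<^bsub>twisted_product\<^esub>"
    by (rule bexI[of _ "(f1 \<otimes>\<^bsub>M\<^esub> (f (inv\<^bsub>P\<^esub> x, x) \<otimes>\<^bsub>M\<^esub> inv\<^bsub>M\<^esub> \<rho> (\<phi> (inv\<^bsub>P\<^esub> x)) m), inv\<^bsub>P\<^esub> x)"])
      (simp_all add: M.m_assoc)
next
  fix u assume "u \<in> carrier twisted_product"
  then obtain m x where [simp]: "u = (m, x)" "m \<in> carrier M" "x \<in> carrier P" by auto
  show "\<one>\<^bsub>twisted_product\<^esub> \<otimes>\<^bsub>twisted_product\<^esub> u = u"
    by (simp add: phi_one_action f_one_left[of x] M.m_assoc)
qed auto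

sublocale T: group twisted_product
  by (rule group_twisted_product)

text \<open>The image of \<open>m\<close> is \<open>m\<close> times the unit
  \<open>(f1, \<one>)\<close>. By \<open>phi_one_action\<close> and \<open>f_one_left\<close> its
  \<open>f1\<close> cancels against the twist.\<close>

lemma kappa_mult:
  assumes "m \<in> carrier M" "n \<in> carrier M" "y \<in> carrier P"
  shows "(m \<otimes>\<^bsub>M\<^esub> f1, \<one>\<^bsub>P\<^esub>) \<otimes>\<^bsub>twisted_product\<^esub> (n, y) = (m \<otimes>\<^bsub>M\<^esub> n, y)"
  using assms by (simp add: phi_one_action f_one_left[of y] M.m_assoc)

text \<open>The action turns \<open>f1\<close> into \<open>\<rho> (\<phi> x) f1\<close>, which by
  \<open>f_one_right\<close> is exactly what the twist removes.\<close>

lemma mult_kappa: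
  assumes "m \<in> carrier M" "n \<in> carrier M" "x \<in> carrier P"
  shows "(n, x) \<otimes>\<^bsub>twisted_product\<^esub> (m \<otimes>\<^bsub>M\<^esub> f1, \<one>\<^bsub>P\<^esub>) = (n \<otimes>\<^bsub>M\<^esub> \<rho> (\<phi> x) m, x)"
  using assms by (simp add: f_one_right[of x] M.m_assoc)

text \<open>The section \<open>x \<mapsto> (\<one>, x)\<close> recovers the given cocycle on the
  nose, so every cocycle is a factor set.\<close>

lemma factor_set_twisted_product:
  "factor_set M L d \<rho> P twisted_product (\<lambda>m. (m \<otimes>\<^bsub>M\<^esub> f1, \<one>\<^bsub>P\<^esub>)) snd
     (\<lambda>(m, x). d m \<otimes>\<^bsub>L\<^esub> \<phi> x) (\<lambda>x. (\<one>\<^bsub>M\<^esub>, x)) f \<phi>"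
proof unfold_locales
  show "(\<lambda>m. (m \<otimes>\<^bsub>M\<^esub> f1, \<one>\<^bsub>P\<^esub>)) \<in> mon M twisted_product"
    by (auto simp: mon_def inj_on_def phi_one_action M.m_assoc intro!: homI)
  show "snd \<in> epi twisted_product P"
    by (auto simp: epi_def hom_def image_def)
  show "kernel twisted_product P snd = (\<lambda>m. (m \<otimes>\<^bsub>M\<^esub> f1, \<one>\<^bsub>P\<^esub>)) ` carrier M"
  proof (intro equalityI subsetI)
    fix u assume "u \<in> kernel twisted_product P snd"
    then obtain m where "m \<in> carrier M" "u = (m, \<one>\<^bsub>P\<^esub>)"
      by (auto simp: kernel_def)
    then show "u \<in> (\<lambda>m. (m \<otimes>\<^bsub>M\<^esub> f1, \<one>\<^bsub>P\<^esub>)) ` carrier M"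
      by (intro image_eqI[of _ _ "m \<otimes>\<^bsub>M\<^esub> inv\<^bsub>M\<^esub> f1"]) (simp_all add: M.m_assoc)
  qed (auto simp: kernel_def)
  show "(\<lambda>(m, x). d m \<otimes>\<^bsub>L\<^esub> \<phi> x) \<in> hom twisted_product L"
    by (rule homI) (auto simp: phi_mult equivariance L.m_assoc)
next
  fix b m assume "b \<in> carrier twisted_product" and [simp]: "m \<in> carrier M"
  then obtain n x where [simp]: "b = (n, x)" "n \<in> carrier M" "x \<in> carrier P" by auto
  \<comment> \<open>The conjugation law is first shown with \<open>b\<close> moved to the other
    side, which avoids computing inverses in the twisted product. Products stay folded at first so
    that \<open>kappa_mult\<close> and \<open>mult_kappa\<close> apply.\<close>
  have "b \<otimes>\<^bsub>twisted_product\<^esub> (m \<otimes>\<^bsub>M\<^esub> f1, \<one>\<^bsub>P\<^esub>) =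
    (\<rho> (d n \<otimes>\<^bsub>L\<^esub> \<phi> x) m \<otimes>\<^bsub>M\<^esub> f1, \<one>\<^bsub>P\<^esub>) \<otimes>\<^bsub>twisted_product\<^esub> b"
    by (simp add: kappa_mult mult_kappa del: twisted_product_simps(2))
      (simp add: action_comp peiffer M.m_assoc)
  then show "b \<otimes>\<^bsub>twisted_product\<^esub> (m \<otimes>\<^bsub>M\<^esub> f1, \<one>\<^bsub>P\<^esub>) \<otimes>\<^bsub>twisted_product\<^esub> inv\<^bsub>twisted_product\<^esub> b =
    (\<rho> (case b of (m, x) \<Rightarrow> d m \<otimes>\<^bsub>L\<^esub> \<phi> x) m \<otimes>\<^bsub>M\<^esub> f1, \<one>\<^bsub>P\<^esub>)"
    by (subst T.inv_solve_right') (simp_all add: kappa_mult del: twisted_product_simps(2))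
next
  fix x y assume [simp]: "x \<in> carrier P" "y \<in> carrier P"
  show "(\<one>\<^bsub>M\<^esub>, x \<otimes>\<^bsub>P\<^esub> y) = (f (x, y) \<otimes>\<^bsub>M\<^esub> f1, \<one>\<^bsub>P\<^esub>) \<otimes>\<^bsub>twisted_product\<^esub>
      ((\<one>\<^bsub>M\<^esub>, x) \<otimes>\<^bsub>twisted_product\<^esub> (\<one>\<^bsub>M\<^esub>, y))"
    by (simp add: phi_one_action f_one_left[of "x \<otimes>\<^bsub>P\<^esub> y"] M.m_assoc M.inv_mult_group)
qed (auto simp: phi_one L.m_assoc)

end

lemma (in factor_set) cocycle: "cocycle M L d \<rho> P f \<phi>"
  by unfold_locales (simp_all add: phi_mult factor_identity)

section \<open>Morphisms of extensions over an element of \<open>L\<close>\<close>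

locale extension_pair =
  E: extension M L d \<rho> P B \<kappa> \<sigma> r + E': extension M L d \<rho> P B' \<kappa>' \<sigma>' r'
  for M :: "('m, 'mm) monoid_scheme" and L :: "('l, 'll) monoid_scheme" and d \<rho>
    and P :: "('p, 'pp) monoid_scheme" and B :: "'b monoid" and \<kappa> \<sigma> r
    and B' :: "'c monoid" and \<kappa>' \<sigma>' r' +
  fixes \<tau> :: 'l
  assumes tau_closed [simp]: "\<tau> \<in> carrier L"
begin

text \<open>For \<open>\<tau> = \<one>\<close> this is the condition in \<open>congruence\<close>,
  for general \<open>\<tau>\<close> the one in \<open>weak_congruence\<close> without
  bijectivity.\<close>

definition twisted_morphism :: "('b \<Rightarrow> 'c) \<Rightarrow> bool" where
  "twisted_morphism \<alpha> \<longleftrightarrow> \<alpha> \<in> hom B B' \<and>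
     (\<forall>m \<in> carrier M. \<alpha> (\<kappa> m) = \<kappa>' (\<rho> \<tau> m)) \<and>
     (\<forall>b \<in> carrier B. \<sigma>' (\<alpha> b) = \<sigma> b) \<and>
     (\<forall>b \<in> carrier B. inv\<^bsub>L\<^esub> \<tau> \<otimes>\<^bsub>L\<^esub> r' (\<alpha> b) \<otimes>\<^bsub>L\<^esub> \<tau> = r b)"

text \<open>The short five lemma: \<open>\<alpha>\<close> induces the automorphism
  \<open>\<rho> \<tau>\<close> on \<open>M\<close> and the identity on \<open>P\<close>.\<close>

lemma twisted_morphism_iso:
  assumes "twisted_morphism \<alpha>"
  shows "\<alpha> \<in> iso B B'"
proof -
  have kappa: "\<alpha> (\<kappa> m) = \<kappa>' (\<rho> \<tau> m)" if "m \<in> carrier M" for m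
    using assms that by (simp add: twisted_morphism_def)
  have sigma [simp]: "\<sigma>' (\<alpha> b) = \<sigma> b" if "b \<in> carrier B" for b
    using assms that by (simp add: twisted_morphism_def)
  interpret \<alpha>: group_hom B B' \<alpha>
    using assms by unfold_locales (simp add: twisted_morphism_def)
  have "kernel B B' \<alpha> = {\<one>\<^bsub>B\<^esub>}"
  proof (intro equalityI subsetI)
    fix b assume "b \<in> kernel B B' \<alpha>"
    then have b: "b \<in> carrier B" "\<alpha> b = \<one>\<^bsub>B'\<^esub>"
      by (simp_all add: kernel_def)
    then have "\<sigma> b = \<sigma> \<one>\<^bsub>B\<^esub>"
      using sigma[of b] by simp
    then obtain m where m: "m \<in> carrier M" "b = \<kappa> m"
      using E.same_fibre[of b "\<one>\<^bsub>B\<^esub>"] b(1) by auto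
    then have "\<kappa>' (\<rho> \<tau> m) = \<kappa>' \<one>\<^bsub>M\<^esub>"
      using b(2) kappa by simp
    then have "\<rho> \<tau> m = \<one>\<^bsub>M\<^esub>"
      using m E'.kappa_eq_iff by (simp del: E'.\<kappa>.hom_one)
    then have "m = \<one>\<^bsub>M\<^esub>"
      using E.action_inv_action(2)[of \<tau> m] m by simp
    then show "b \<in> {\<one>\<^bsub>B\<^esub>}"
      using m by simp
  qed (simp add: kernel_def)
  then have "inj_on \<alpha> (carrier B)"
    by (rule \<alpha>.trivial_ker_imp_inj)
  moreover have "carrier B' \<subseteq> \<alpha> ` carrier B"
  proof
    fix c assume c: "c \<in> carrier B'"
    then obtain b where b: "b \<in> carrier B" "\<sigma> b = \<sigma>' c"
      using E.sigma_surj[of "\<sigma>' c"] by auto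
    then obtain m where m: "m \<in> carrier M" "c = \<kappa>' m \<otimes>\<^bsub>B'\<^esub> \<alpha> b"
      using E'.same_fibre[of c "\<alpha> b"] c by auto
    \<comment> \<open>The lift \<open>b\<close> has the right image in \<open>P\<close>; the error
      \<open>m\<close> is corrected by its preimage under \<open>\<rho> \<tau>\<close>.\<close>
    have "c = \<alpha> (\<kappa> (\<rho> (inv\<^bsub>L\<^esub> \<tau>) m) \<otimes>\<^bsub>B\<^esub> b)"
      using m b by (simp add: kappa)
    then show "c \<in> \<alpha> ` carrier B"
      by (rule image_eqI) (use m b in simp)
  qed
  ultimately show ?thesis
    using \<alpha>.homh by (auto simp: iso_def bij_betw_def)
qed

end

section \<open>Morphisms over \<tau> correspond to cochains \<open>t\<close>\<close>

locale factor_set_pair = extension_pair M L d \<rho> P B \<kappa> \<sigma> r B' \<kappa>' \<sigma>' r' \<tau> +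
  F: factor_set M L d \<rho> P B \<kappa> \<sigma> r s f \<phi> + F': factor_set M L d \<rho> P B' \<kappa>' \<sigma>' r' s' f' \<phi>'
  for M :: "('m, 'mm) monoid_scheme" and L :: "('l, 'll) monoid_scheme" and d \<rho>
    and P :: "('p, 'pp) monoid_scheme" and B :: "'b monoid" and \<kappa> \<sigma> r s f \<phi>
    and B' :: "'c monoid" and \<kappa>' \<sigma>' r' s' f' \<phi>' \<tau>
begin

definition twisted_coboundary :: "('p \<Rightarrow> 'm) \<Rightarrow> bool" where
  "twisted_coboundary t \<longleftrightarrow> t \<in> carrier P \<rightarrow> carrier M \<and>
     (\<forall>x \<in> carrier P. \<forall>y \<in> carrier P.
        f' (x, y) =
          inv\<^bsub>M\<^esub> t (x \<otimes>\<^bsub>P\<^esub> y) \<otimes>\<^bsub>M\<^esub> \<rho> \<tau> (f (x, y)) \<otimes>\<^bsub>M\<^esub> t x \<otimes>\<^bsub>M\<^esub> \<rho> (\<phi>' x) (t y)) \<and>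
     (\<forall>x \<in> carrier P. \<phi> x = inv\<^bsub>L\<^esub> \<tau> \<otimes>\<^bsub>L\<^esub> d (t x) \<otimes>\<^bsub>L\<^esub> \<phi>' x \<otimes>\<^bsub>L\<^esub> \<tau>)"

text \<open>\<open>\<alpha> (s x)\<close> and \<open>s' x\<close> lie over the same
  \<open>x\<close>, and \<open>t x\<close> is their difference in \<open>M\<close>.\<close>

lemma twisted_coboundary_of_morphism:
  assumes "twisted_morphism \<alpha>"
  shows "\<exists>t. twisted_coboundary t"
proof -
  interpret \<alpha>: group_hom B B' \<alpha>
    using assms by unfold_locales (simp add: twisted_morphism_def)
  have kappa [simp]: "\<alpha> (\<kappa> m) = \<kappa>' (\<rho> \<tau> m)" if "m \<in> carrier M" for m
    using assms that by (simp add: twisted_morphism_def)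
  have sigma [simp]: "\<sigma>' (\<alpha> b) = \<sigma> b" if "b \<in> carrier B" for b
    using assms that by (simp add: twisted_morphism_def)
  have r: "inv\<^bsub>L\<^esub> \<tau> \<otimes>\<^bsub>L\<^esub> r' (\<alpha> b) \<otimes>\<^bsub>L\<^esub> \<tau> = r b" if "b \<in> carrier B" for b
    using assms that by (simp add: twisted_morphism_def)
  have "\<forall>x\<in>carrier P. \<exists>m. m \<in> carrier M \<and> \<alpha> (s x) = \<kappa>' m \<otimes>\<^bsub>B'\<^esub> s' x"
  proof
    fix x assume "x \<in> carrier P"
    then show "\<exists>m. m \<in> carrier M \<and> \<alpha> (s x) = \<kappa>' m \<otimes>\<^bsub>B'\<^esub> s' x"
      using E'.same_fibre[of "\<alpha> (s x)" "s' x"] by auto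
  qed
  then obtain t where t [simp]: "x \<in> carrier P \<Longrightarrow> t x \<in> carrier M"
    and alpha_s: "x \<in> carrier P \<Longrightarrow> \<alpha> (s x) = \<kappa>' (t x) \<otimes>\<^bsub>B'\<^esub> s' x" for x
    by metis
  have "f' (x, y) =
      inv\<^bsub>M\<^esub> t (x \<otimes>\<^bsub>P\<^esub> y) \<otimes>\<^bsub>M\<^esub> \<rho> \<tau> (f (x, y)) \<otimes>\<^bsub>M\<^esub> t x \<otimes>\<^bsub>M\<^esub> \<rho> (\<phi>' x) (t y)"
    if [simp]: "x \<in> carrier P" "y \<in> carrier P" for x y
  proof -
    let ?u = "t x \<otimes>\<^bsub>M\<^esub> \<rho> (\<phi>' x) (t y) \<otimes>\<^bsub>M\<^esub> inv\<^bsub>M\<^esub> f' (x, y)"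
    \<comment> \<open>Compute \<open>\<alpha> (s (x \<otimes> y))\<close> directly and through
      \<open>s_mult\<close>, compare the \<open>M\<close>-coordinates in \<open>B'\<close>, and
      solve for \<open>f' (x, y)\<close>.\<close>
    have "\<kappa>' (t (x \<otimes>\<^bsub>P\<^esub> y)) \<otimes>\<^bsub>B'\<^esub> s' (x \<otimes>\<^bsub>P\<^esub> y) = \<alpha> (s (x \<otimes>\<^bsub>P\<^esub> y))"
      by (simp add: alpha_s)
    also have "\<dots> = \<kappa>' (\<rho> \<tau> (f (x, y))) \<otimes>\<^bsub>B'\<^esub>
        ((\<kappa>' (t x) \<otimes>\<^bsub>B'\<^esub> s' x) \<otimes>\<^bsub>B'\<^esub> (\<kappa>' (t y) \<otimes>\<^bsub>B'\<^esub> s' y))"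
      by (simp add: F.s_mult alpha_s)
    also have "\<dots> = \<kappa>' (\<rho> \<tau> (f (x, y))) \<otimes>\<^bsub>B'\<^esub> (\<kappa>' ?u \<otimes>\<^bsub>B'\<^esub> s' (x \<otimes>\<^bsub>P\<^esub> y))"
      by (subst F'.kappa_s_mult) simp_all
    also have "\<dots> = \<kappa>' (\<rho> \<tau> (f (x, y)) \<otimes>\<^bsub>M\<^esub> ?u) \<otimes>\<^bsub>B'\<^esub> s' (x \<otimes>\<^bsub>P\<^esub> y)"
      by (simp add: E'.B.m_assoc)
    finally have "t (x \<otimes>\<^bsub>P\<^esub> y) = \<rho> \<tau> (f (x, y)) \<otimes>\<^bsub>M\<^esub> ?u"
      by (subst (asm) F'.kappa_s_eq_iff) simp_all
    then show ?thesis
      by (simp add: E.M.m_assoc E.M.inv_mult_group)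
  qed
  moreover have "\<phi> x = inv\<^bsub>L\<^esub> \<tau> \<otimes>\<^bsub>L\<^esub> d (t x) \<otimes>\<^bsub>L\<^esub> \<phi>' x \<otimes>\<^bsub>L\<^esub> \<tau>" if [simp]: "x \<in> carrier P" for x
    using r[of "s x"] by (simp add: alpha_s E.L.m_assoc)
  ultimately show ?thesis
    unfolding twisted_coboundary_def by (intro exI[of _ t]) auto
qed

lemma twisted_morphism_of_coboundary:
  assumes "twisted_coboundary t"
  shows "\<exists>\<alpha>. twisted_morphism \<alpha>"
proof -
  have t [simp]: "t x \<in> carrier M" if "x \<in> carrier P" for x
    using assms that by (auto simp: twisted_coboundary_def)
  have f': "f' (x, y) =
      inv\<^bsub>M\<^esub> t (x \<otimes>\<^bsub>P\<^esub> y) \<otimes>\<^bsub>M\<^esub> \<rho> \<tau> (f (x, y)) \<otimes>\<^bsub>M\<^esub> t x \<otimes>\<^bsub>M\<^esub> \<rho> (\<phi>' x) (t y)"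
    if "x \<in> carrier P" "y \<in> carrier P" for x y
    using assms that by (auto simp: twisted_coboundary_def)
  have \<phi>: "\<phi> x = inv\<^bsub>L\<^esub> \<tau> \<otimes>\<^bsub>L\<^esub> (d (t x) \<otimes>\<^bsub>L\<^esub> (\<phi>' x \<otimes>\<^bsub>L\<^esub> \<tau>))" if "x \<in> carrier P" for x
    using assms that by (auto simp: twisted_coboundary_def E.L.m_assoc)
  \<comment> \<open>The relation for \<open>\<phi>\<close> reads \<open>\<tau> \<otimes> \<phi> x =
    d (t x) \<otimes> \<phi>' x \<otimes> \<tau>\<close>, and \<open>d (t x)\<close> acts by
    conjugation.\<close>
  have tau_phi: "\<rho> \<tau> (\<rho> (\<phi> x) m) = t x \<otimes>\<^bsub>M\<^esub> (\<rho> (\<phi>' x) (\<rho> \<tau> m) \<otimes>\<^bsub>M\<^esub> inv\<^bsub>M\<^esub> t x)"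
    if "x \<in> carrier P" "m \<in> carrier M" for x m
    using that by (simp add: \<phi> E.action_comp E.peiffer E.M.m_assoc)
  \<comment> \<open>The \<open>M\<close>-coordinate with respect to \<open>s\<close>; the
    description is proper because \<open>\<kappa>\<close> is injective.\<close>
  define c where "c b = (THE m. m \<in> carrier M \<and> b = \<kappa> m \<otimes>\<^bsub>B\<^esub> s (\<sigma> b))" for b
  have c [simp]: "c (\<kappa> m \<otimes>\<^bsub>B\<^esub> s x) = m" if "m \<in> carrier M" "x \<in> carrier P" for m x
    unfolding c_def by (rule the_equality) (use that in auto)
  \<comment> \<open>Forced by the required values on \<open>\<kappa> m\<close> and on
    \<open>s x\<close>.\<close>
  define \<alpha> where "\<alpha> b = \<kappa>' (\<rho> \<tau> (c b) \<otimes>\<^bsub>M\<^esub> t (\<sigma> b)) \<otimes>\<^bsub>B'\<^esub> s' (\<sigma> b)" for b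
  have alpha: "\<alpha> (\<kappa> m \<otimes>\<^bsub>B\<^esub> s x) = \<kappa>' (\<rho> \<tau> m \<otimes>\<^bsub>M\<^esub> t x) \<otimes>\<^bsub>B'\<^esub> s' x"
    if "m \<in> carrier M" "x \<in> carrier P" for m x
    using that by (simp add: \<alpha>_def)
  have cases: "\<exists>m x. m \<in> carrier M \<and> x \<in> carrier P \<and> b = \<kappa> m \<otimes>\<^bsub>B\<^esub> s x" if "b \<in> carrier B" for b
    using F.kappa_s_cases[OF that] that by (metis E.\<sigma>.hom_closed)
  have hom: "\<alpha> \<in> hom B B'"
  proof (rule homI)
    fix b assume "b \<in> carrier B"
    then obtain m x where "m \<in> carrier M" "x \<in> carrier P" "b = \<kappa> m \<otimes>\<^bsub>B\<^esub> s x"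
      using cases by blast
    then show "\<alpha> b \<in> carrier B'" by (simp add: alpha)
  next
    fix b b' assume "b \<in> carrier B" "b' \<in> carrier B"
    then obtain m x n y where [simp]: "m \<in> carrier M" "x \<in> carrier P" "n \<in> carrier M" "y \<in> carrier P"
      and b: "b = \<kappa> m \<otimes>\<^bsub>B\<^esub> s x" "b' = \<kappa> n \<otimes>\<^bsub>B\<^esub> s y"
      using cases by metis
    let ?l = "\<rho> \<tau> (m \<otimes>\<^bsub>M\<^esub> \<rho> (\<phi> x) n \<otimes>\<^bsub>M\<^esub> inv\<^bsub>M\<^esub> f (x, y)) \<otimes>\<^bsub>M\<^esub> t (x \<otimes>\<^bsub>P\<^esub> y)"
    let ?r = "(\<rho> \<tau> m \<otimes>\<^bsub>M\<^esub> t x) \<otimes>\<^bsub>M\<^esub> \<rho> (\<phi>' x) (\<rho> \<tau> n \<otimes>\<^bsub>M\<^esub> t y) \<otimes>\<^bsub>M\<^esub> inv\<^bsub>M\<^esub> f' (x, y)"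
    have "\<alpha> (b \<otimes>\<^bsub>B\<^esub> b') =
        \<alpha> (\<kappa> (m \<otimes>\<^bsub>M\<^esub> \<rho> (\<phi> x) n \<otimes>\<^bsub>M\<^esub> inv\<^bsub>M\<^esub> f (x, y)) \<otimes>\<^bsub>B\<^esub> s (x \<otimes>\<^bsub>P\<^esub> y))"
      unfolding b by (subst F.kappa_s_mult) simp_all
    also have "\<dots> = \<kappa>' ?l \<otimes>\<^bsub>B'\<^esub> s' (x \<otimes>\<^bsub>P\<^esub> y)"
      by (rule alpha) simp_all
    \<comment> \<open>This is the coboundary formula for \<open>f'\<close>, after
      \<open>tau_phi\<close> has moved \<open>\<tau>\<close> past \<open>\<phi> x\<close>.\<close>
    also have "?l = ?r"
      by (simp add: f' tau_phi E.M.m_assoc E.M.inv_mult_group)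
    also have "\<kappa>' ?r \<otimes>\<^bsub>B'\<^esub> s' (x \<otimes>\<^bsub>P\<^esub> y) =
        (\<kappa>' (\<rho> \<tau> m \<otimes>\<^bsub>M\<^esub> t x) \<otimes>\<^bsub>B'\<^esub> s' x) \<otimes>\<^bsub>B'\<^esub> (\<kappa>' (\<rho> \<tau> n \<otimes>\<^bsub>M\<^esub> t y) \<otimes>\<^bsub>B'\<^esub> s' y)"
      by (rule F'.kappa_s_mult[symmetric]) simp_all
    also have "\<dots> = \<alpha> b \<otimes>\<^bsub>B'\<^esub> \<alpha> b'"
      by (simp add: b alpha del: E'.\<kappa>.hom_mult)
    finally show "\<alpha> (b \<otimes>\<^bsub>B\<^esub> b') = \<alpha> b \<otimes>\<^bsub>B'\<^esub> \<alpha> b'" .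
  qed
  interpret \<alpha>: group_hom B B' \<alpha>
    using hom by unfold_locales
  let ?f1 = "f (\<one>\<^bsub>P\<^esub>, \<one>\<^bsub>P\<^esub>)" and ?f1' = "f' (\<one>\<^bsub>P\<^esub>, \<one>\<^bsub>P\<^esub>)"
  have "\<kappa>' (\<rho> \<tau> ?f1 \<otimes>\<^bsub>M\<^esub> t \<one>\<^bsub>P\<^esub>) \<otimes>\<^bsub>B'\<^esub> s' \<one>\<^bsub>P\<^esub> = \<alpha> \<one>\<^bsub>B\<^esub>"
    using alpha[of ?f1 "\<one>\<^bsub>P\<^esub>"] by (simp add: F.kappa_f_one)
  also have "\<dots> = \<kappa>' ?f1' \<otimes>\<^bsub>B'\<^esub> s' \<one>\<^bsub>P\<^esub>"
    by (simp add: F'.kappa_f_one)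
  \<comment> \<open>Preservation of the unit, whose coordinates in both groups are known from
    \<open>kappa_f_one\<close>, relates \<open>f\<close> and \<open>f'\<close> at the unit.\<close>
  finally have one: "\<rho> \<tau> ?f1 \<otimes>\<^bsub>M\<^esub> t \<one>\<^bsub>P\<^esub> = ?f1'"
    by (subst (asm) F'.kappa_s_eq_iff) simp_all
  have "\<alpha> (\<kappa> m) = \<kappa>' (\<rho> \<tau> m)" if [simp]: "m \<in> carrier M" for m
  proof -
    \<comment> \<open>\<open>\<alpha>\<close> is known on normal forms only, and that of
      \<open>\<kappa> m\<close> involves \<open>f (\<one>, \<one>)\<close> because \<open>s\<close>
      is not normalized.\<close>
    have "\<alpha> (\<kappa> m) = \<alpha> (\<kappa> (m \<otimes>\<^bsub>M\<^esub> ?f1) \<otimes>\<^bsub>B\<^esub> s \<one>\<^bsub>P\<^esub>)"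
      by (simp add: E.B.m_assoc F.kappa_f_one del: \<alpha>.hom_mult)
    also have "\<dots> = \<kappa>' (\<rho> \<tau> (m \<otimes>\<^bsub>M\<^esub> ?f1) \<otimes>\<^bsub>M\<^esub> t \<one>\<^bsub>P\<^esub>) \<otimes>\<^bsub>B'\<^esub> s' \<one>\<^bsub>P\<^esub>"
      by (rule alpha) simp_all
    also have "\<rho> \<tau> (m \<otimes>\<^bsub>M\<^esub> ?f1) \<otimes>\<^bsub>M\<^esub> t \<one>\<^bsub>P\<^esub> = \<rho> \<tau> m \<otimes>\<^bsub>M\<^esub> ?f1'"
      by (simp add: E.M.m_assoc one)
    finally show ?thesis
      by (simp add: E'.B.m_assoc F'.kappa_f_one)
  qed
  moreover have "\<sigma>' (\<alpha> b) = \<sigma> b \<and> inv\<^bsub>L\<^esub> \<tau> \<otimes>\<^bsub>L\<^esub> r' (\<alpha> b) \<otimes>\<^bsub>L\<^esub> \<tau> = r b"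
    if b: "b \<in> carrier B" for b
  proof -
    obtain m x where "m \<in> carrier M" "x \<in> carrier P" "b = \<kappa> m \<otimes>\<^bsub>B\<^esub> s x"
      using cases[OF b] by blast
    \<comment> \<open>By \<open>equivariance\<close>, \<open>d (\<rho> \<tau> m)\<close> is a
      conjugate of \<open>d m\<close> by \<open>\<tau>\<close>, so undoing the conjugation leaves
      \<open>d m \<otimes> \<phi> x\<close>.\<close>
    then show ?thesis
      by (simp add: alpha \<phi> E.equivariance E.L.m_assoc del: \<alpha>.hom_mult)
  qed
  ultimately show ?thesis
    unfolding twisted_morphism_def using hom by (intro exI[of _ \<alpha>] conjI ballI) simp_all
qed

lemma twisted_morphism_iff_coboundary:
  "(\<exists>\<alpha>. twisted_morphism \<alpha>) \<longleftrightarrow> (\<exists>t. twisted_coboundary t)"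
  using twisted_coboundary_of_morphism twisted_morphism_of_coboundary by blast

end

section \<open>Equivalence relations over a subgroup of \<open>L\<close> and the resulting
  bijections\<close>

locale crossed_module_coefficients = crossed_module M L d \<rho> + P: group P
  for M :: "('m, 'mm) monoid_scheme" and L :: "('l, 'll) monoid_scheme" and d \<rho>
    and P :: "('p, 'pp) monoid_scheme"
begin

text \<open>
  Restricting \<open>\<tau>\<close> to a subgroup \<open>T\<close> of \<open>L\<close> treats both halves of the theorem at once:
  \<open>T\<close> is trivial for congruence and all of \<open>L\<close> for weak congruence.
\<close>

definition ext_rel :: "'l set \<Rightarrow> ('m, 'l, 'p, 'b) ext rel" where
  "ext_rel T = {((B, \<kappa>, \<sigma>, r), (B', \<kappa>', \<sigma>', r')).
     (B, \<kappa>, \<sigma>, r) \<in> extensions M L d \<rho> P \<and> (B', \<kappa>', \<sigma>', r') \<in> extensions M L d \<rho> P \<and>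
     (\<exists>\<alpha>. \<exists>\<tau> \<in> T. \<alpha> \<in> hom B B' \<and>
        (\<forall>m \<in> carrier M. \<alpha> (\<kappa> m) = \<kappa>' (\<rho> \<tau> m)) \<and>
        (\<forall>b \<in> carrier B. \<sigma>' (\<alpha> b) = \<sigma> b) \<and>
        (\<forall>b \<in> carrier B. inv\<^bsub>L\<^esub> \<tau> \<otimes>\<^bsub>L\<^esub> r' (\<alpha> b) \<otimes>\<^bsub>L\<^esub> \<tau> = r b))}"

definition cocycle_rel :: "'l set \<Rightarrow> ('m, 'l, 'p) cochain rel" where
  "cocycle_rel T = {((f', \<phi>'), (f, \<phi>)).
     (f', \<phi>') \<in> cocycles M L d \<rho> P \<and> (f, \<phi>) \<in> cocycles M L d \<rho> P \<and>
     (\<exists>t \<in> carrier P \<rightarrow> carrier M. \<exists>\<tau> \<in> T.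
        (\<forall>x \<in> carrier P. \<forall>y \<in> carrier P.
           f' (x, y) =
             inv\<^bsub>M\<^esub> t (x \<otimes>\<^bsub>P\<^esub> y) \<otimes>\<^bsub>M\<^esub> \<rho> \<tau> (f (x, y)) \<otimes>\<^bsub>M\<^esub> t x \<otimes>\<^bsub>M\<^esub> \<rho> (\<phi>' x) (t y)) \<and>
        (\<forall>x \<in> carrier P. \<phi> x = inv\<^bsub>L\<^esub> \<tau> \<otimes>\<^bsub>L\<^esub> d (t x) \<otimes>\<^bsub>L\<^esub> \<phi>' x \<otimes>\<^bsub>L\<^esub> \<tau>))}"

lemma extensions_iff [simp]:
  "(B, \<kappa>, \<sigma>, r) \<in> extensions M L d \<rho> P \<longleftrightarrow> extension M L d \<rho> P B \<kappa> \<sigma> r"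
  using P.is_group by (rule mem_extensions_iff)

text \<open>The locale constrains values on the carriers only, so extensionality is split
  off.\<close>

lemma cocycles_iff:
  "(f, \<phi>) \<in> cocycles M L d \<rho> P \<longleftrightarrow> cocycle M L d \<rho> P f \<phi> \<and>
     f \<in> extensional (carrier P \<times> carrier P) \<and> \<phi> \<in> extensional (carrier P)"
proof -
  have "crossed_module M L d \<rho>" "group P" by unfold_locales
  then show ?thesis
    unfolding cocycles_def cocycle_def cocycle_axioms_def by (auto simp: PiE_iff)
qed

lemma extension_pairI:
  assumes "extension M L d \<rho> P B \<kappa> \<sigma> r" "extension M L d \<rho> P B' \<kappa>' \<sigma>' r'" "\<tau> \<in> carrier L"
  shows "extension_pair M L d \<rho> P B \<kappa> \<sigma> r B' \<kappa>' \<sigma>' r' \<tau>"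
  using assms by (simp add: extension_pair_def extension_pair_axioms_def)

lemma congruence_eq: "(congruence M L d \<rho> P :: ('m, 'l, 'p, 'b) ext rel) = ext_rel {\<one>\<^bsub>L\<^esub>}"
proof -
  have "(E, E') \<in> congruence M L d \<rho> P \<longleftrightarrow> (E, E') \<in> ext_rel {\<one>\<^bsub>L\<^esub>}" for E E' :: "('m, 'l, 'p, 'b) ext"
  proof -
    obtain B \<kappa> \<sigma> r where E: "E = (B, \<kappa>, \<sigma>, r)" by (cases E)
    obtain B' \<kappa>' \<sigma>' r' where E': "E' = (B', \<kappa>', \<sigma>', r')" by (cases E')
    show ?thesis
    proof (cases "extension M L d \<rho> P B' \<kappa>' \<sigma>' r'")
      case True
      then interpret E': extension M L d \<rho> P B' \<kappa>' \<sigma>' r' .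
      \<comment> \<open>Membership in \<open>L\<close> is what allows the conjugation by
        \<open>\<one>\<close> to be simplified away.\<close>
      have "r' (\<alpha> b) \<in> carrier L" if "\<alpha> \<in> hom B B'" "b \<in> carrier B" for \<alpha> b
        using that by (simp add: hom_def Pi_iff)
      then show ?thesis
        by (simp add: E E' congruence_def ext_rel_def Bex_def cong: conj_cong)
    qed (simp add: E E' congruence_def ext_rel_def)
  qed
  then show ?thesis by (intro equalityI subrelI) blast+
qed

text \<open>\<open>ext_rel\<close> asks only for a homomorphism; \<open>twisted_morphism_iso\<close>
  supplies the bijectivity.\<close>

lemma weak_congruence_eq: "(weak_congruence M L d \<rho> P :: ('m, 'l, 'p, 'b) ext rel) = ext_rel (carrier L)"
proof -
  have iso: "\<alpha> \<in> iso B B'"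
    if "extension M L d \<rho> P B \<kappa> \<sigma> r" "extension M L d \<rho> P B' \<kappa>' \<sigma>' r'" "\<tau> \<in> carrier L"
      "\<alpha> \<in> hom B B'" "\<forall>m\<in>carrier M. \<alpha> (\<kappa> m) = \<kappa>' (\<rho> \<tau> m)" "\<forall>b\<in>carrier B. \<sigma>' (\<alpha> b) = \<sigma> b"
      "\<forall>b\<in>carrier B. inv\<^bsub>L\<^esub> \<tau> \<otimes>\<^bsub>L\<^esub> r' (\<alpha> b) \<otimes>\<^bsub>L\<^esub> \<tau> = r b"
    for B :: "'b monoid" and \<kappa> \<sigma> r and B' :: "'b monoid" and \<kappa>' \<sigma>' r' \<tau> \<alpha>
  proof -
    interpret extension_pair M L d \<rho> P B \<kappa> \<sigma> r B' \<kappa>' \<sigma>' r' \<tau>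
      using that by (intro extension_pairI)
    show ?thesis
      by (rule twisted_morphism_iso) (use that in \<open>simp add: twisted_morphism_def\<close>)
  qed
  show ?thesis
  proof (intro equalityI subrelI)
    fix E E' :: "('m, 'l, 'p, 'b) ext" assume "(E, E') \<in> weak_congruence M L d \<rho> P"
    then show "(E, E') \<in> ext_rel (carrier L)"
      by (auto simp: weak_congruence_def ext_rel_def dest: iso_imp_homomorphism)
  next
    fix E E' :: "('m, 'l, 'p, 'b) ext" assume "(E, E') \<in> ext_rel (carrier L)"
    moreover obtain B \<kappa> \<sigma> r where E: "E = (B, \<kappa>, \<sigma>, r)" by (cases E)
    moreover obtain B' \<kappa>' \<sigma>' r' where E': "E' = (B', \<kappa>', \<sigma>', r')" by (cases E')
    ultimately obtain \<alpha> \<tau> where ext: "extension M L d \<rho> P B \<kappa> \<sigma> r" "extension M L d \<rho> P B' \<kappa>' \<sigma>' r'"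
      and mor: "\<tau> \<in> carrier L" "\<alpha> \<in> hom B B'" "\<forall>m\<in>carrier M. \<alpha> (\<kappa> m) = \<kappa>' (\<rho> \<tau> m)"
        "\<forall>b\<in>carrier B. \<sigma>' (\<alpha> b) = \<sigma> b" "\<forall>b\<in>carrier B. inv\<^bsub>L\<^esub> \<tau> \<otimes>\<^bsub>L\<^esub> r' (\<alpha> b) \<otimes>\<^bsub>L\<^esub> \<tau> = r b"
      by (auto simp: ext_rel_def)
    then have "\<alpha> \<in> iso B B'"
      by (rule iso)
    with ext mor show "(E, E') \<in> weak_congruence M L d \<rho> P"
      unfolding E E' weak_congruence_def by (auto intro!: bexI[of _ \<alpha>] bexI[of _ \<tau>])
  qed
qed

lemma cohomologous_eq: "cohomologous M L d \<rho> P = cocycle_rel {\<one>\<^bsub>L\<^esub>}"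
proof -
  have "\<one>\<^bsub>L\<^esub> \<otimes>\<^bsub>L\<^esub> d (t x) \<otimes>\<^bsub>L\<^esub> \<phi>' x \<otimes>\<^bsub>L\<^esub> \<one>\<^bsub>L\<^esub> = d (t x) \<otimes>\<^bsub>L\<^esub> \<phi>' x"
    if "t \<in> carrier P \<rightarrow> carrier M" "(f', \<phi>') \<in> cocycles M L d \<rho> P" "x \<in> carrier P" for t x f' \<phi>'
    using that by (auto simp: cocycles_def Pi_iff PiE_iff)
  moreover have "\<rho> \<one>\<^bsub>L\<^esub> (f (x, y)) = f (x, y)"
    if "(f, \<phi>) \<in> cocycles M L d \<rho> P" "x \<in> carrier P" "y \<in> carrier P" for f \<phi> x y
    using that by (auto simp: cocycles_def Pi_iff PiE_iff)
  ultimately show ?thesis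
    unfolding cohomologous_def cocycle_rel_def by (intro Collect_cong) (clarsimp, smt (verit))
qed

lemma weakly_cohomologous_eq: "weakly_cohomologous M L d \<rho> P = cocycle_rel (carrier L)"
  by (simp add: weakly_cohomologous_def cocycle_rel_def)

text \<open>Identity, inverse and composite morphisms lie over the unit, the inverse of
  \<open>\<tau>\<close> and the product of the two elements, all of which stay in the subgroup
  \<open>T\<close>.\<close>

lemma equiv_ext_rel:
  assumes T: "subgroup T L"
  shows "equiv (extensions M L d \<rho> P) (ext_rel T :: ('m, 'l, 'p, 'b) ext rel)"
proof (rule equivI)
  note T_closed = subgroup.mem_carrier[OF T]
  show "(ext_rel T :: ('m, 'l, 'p, 'b) ext rel) \<subseteq> extensions M L d \<rho> P \<times> extensions M L d \<rho> P"
    by (auto simp: ext_rel_def)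
  show "refl_on (extensions M L d \<rho> P) (ext_rel T :: ('m, 'l, 'p, 'b) ext rel)"
  proof (rule refl_onI)
    fix E :: "('m, 'l, 'p, 'b) ext" assume "E \<in> extensions M L d \<rho> P"
    moreover obtain B \<kappa> \<sigma> r where E: "E = (B, \<kappa>, \<sigma>, r)" by (cases E)
    ultimately interpret extension M L d \<rho> P B \<kappa> \<sigma> r by simp
    show "(E, E) \<in> ext_rel T"
      unfolding ext_rel_def E using extension_axioms subgroup.one_closed[OF T]
      by (auto intro!: exI[of _ id] bexI[of _ "\<one>\<^bsub>L\<^esub>"] simp: hom_def)
  qed
  show "sym (ext_rel T :: ('m, 'l, 'p, 'b) ext rel)"
  proof (rule symI)
    fix E E' :: "('m, 'l, 'p, 'b) ext" assume rel: "(E, E') \<in> ext_rel T"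
    obtain B \<kappa> \<sigma> r where E: "E = (B, \<kappa>, \<sigma>, r)" by (cases E)
    obtain B' \<kappa>' \<sigma>' r' where E': "E' = (B', \<kappa>', \<sigma>', r')" by (cases E')
    obtain \<alpha> \<tau> where tau: "\<tau> \<in> T" and ext: "extension M L d \<rho> P B \<kappa> \<sigma> r" "extension M L d \<rho> P B' \<kappa>' \<sigma>' r'"
      and alpha: "\<alpha> \<in> hom B B'" "\<And>m. m \<in> carrier M \<Longrightarrow> \<alpha> (\<kappa> m) = \<kappa>' (\<rho> \<tau> m)"
        "\<And>b. b \<in> carrier B \<Longrightarrow> \<sigma>' (\<alpha> b) = \<sigma> b"
        "\<And>b. b \<in> carrier B \<Longrightarrow> inv\<^bsub>L\<^esub> \<tau> \<otimes>\<^bsub>L\<^esub> r' (\<alpha> b) \<otimes>\<^bsub>L\<^esub> \<tau> = r b"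
      using rel unfolding E E' ext_rel_def by auto
    interpret extension_pair M L d \<rho> P B \<kappa> \<sigma> r B' \<kappa>' \<sigma>' r' \<tau>
      using ext T_closed[OF tau] by (intro extension_pairI)
    have iso: "\<alpha> \<in> iso B B'"
      by (rule twisted_morphism_iso) (simp add: twisted_morphism_def alpha)
    define \<beta> where "\<beta> = inv_into (carrier B) \<alpha>"
    have beta: "\<beta> \<in> hom B' B"
      unfolding \<beta>_def by (rule iso_imp_homomorphism[OF E.B.iso_set_sym[OF iso]])
    have bij: "bij_betw \<alpha> (carrier B) (carrier B')"
      using iso by (simp add: iso_def)
    have beta_closed [simp]: "\<beta> c \<in> carrier B" if "c \<in> carrier B'" for c
      using beta that by (auto simp: hom_def)
    have alpha_beta [simp]: "\<alpha> (\<beta> c) = c" if "c \<in> carrier B'" for c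
      using bij that unfolding \<beta>_def by (rule bij_betw_inv_into_right)
    have beta_alpha [simp]: "\<beta> (\<alpha> b) = b" if "b \<in> carrier B" for b
      using bij that unfolding \<beta>_def by (rule bij_betw_inv_into_left)
    \<comment> \<open>Apply \<open>\<beta>\<close> after \<open>\<alpha>\<close> to the right-hand
      side: \<open>\<alpha>\<close> lets \<open>\<tau>\<close> act and so undoes the action of its
      inverse.\<close>
    have "\<beta> (\<kappa>' m) = \<kappa> (\<rho> (inv\<^bsub>L\<^esub> \<tau>) m)" if "m \<in> carrier M" for m
      using beta_alpha[of "\<kappa> (\<rho> (inv\<^bsub>L\<^esub> \<tau>) m)"] that by (simp add: alpha(2))
    moreover have "\<sigma> (\<beta> c) = \<sigma>' c" if "c \<in> carrier B'" for c
      using alpha(3)[of "\<beta> c"] that by simp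
    moreover have "inv\<^bsub>L\<^esub> (inv\<^bsub>L\<^esub> \<tau>) \<otimes>\<^bsub>L\<^esub> r (\<beta> c) \<otimes>\<^bsub>L\<^esub> inv\<^bsub>L\<^esub> \<tau> = r' c" if "c \<in> carrier B'" for c
      using that by (simp flip: alpha(4) add: L.m_assoc)
    ultimately show "(E', E) \<in> ext_rel T"
      unfolding E E' ext_rel_def using ext beta subgroup.m_inv_closed[OF T tau]
      by (auto intro!: exI[of _ \<beta>] bexI[of _ "inv\<^bsub>L\<^esub> \<tau>"] simp del: L.inv_inv)
  qed
  show "trans (ext_rel T :: ('m, 'l, 'p, 'b) ext rel)"
  proof (rule transI)
    fix E E' E'' :: "('m, 'l, 'p, 'b) ext"
    assume rel: "(E, E') \<in> ext_rel T" and rel': "(E', E'') \<in> ext_rel T"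
    obtain B \<kappa> \<sigma> r where E: "E = (B, \<kappa>, \<sigma>, r)" by (cases E)
    obtain B' \<kappa>' \<sigma>' r' where E': "E' = (B', \<kappa>', \<sigma>', r')" by (cases E')
    obtain B'' \<kappa>'' \<sigma>'' r'' where E'': "E'' = (B'', \<kappa>'', \<sigma>'', r'')" by (cases E'')
    obtain \<alpha> \<tau> where tau: "\<tau> \<in> T" and ext: "extension M L d \<rho> P B \<kappa> \<sigma> r"
      and alpha: "\<alpha> \<in> hom B B'" "\<And>m. m \<in> carrier M \<Longrightarrow> \<alpha> (\<kappa> m) = \<kappa>' (\<rho> \<tau> m)"
        "\<And>b. b \<in> carrier B \<Longrightarrow> \<sigma>' (\<alpha> b) = \<sigma> b"
        "\<And>b. b \<in> carrier B \<Longrightarrow> r b = inv\<^bsub>L\<^esub> \<tau> \<otimes>\<^bsub>L\<^esub> r' (\<alpha> b) \<otimes>\<^bsub>L\<^esub> \<tau>"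
      using rel unfolding E E' ext_rel_def by auto
    obtain \<alpha>' \<tau>' where tau': "\<tau>' \<in> T" and ext'': "extension M L d \<rho> P B'' \<kappa>'' \<sigma>'' r''"
      and alpha': "\<alpha>' \<in> hom B' B''" "\<And>m. m \<in> carrier M \<Longrightarrow> \<alpha>' (\<kappa>' m) = \<kappa>'' (\<rho> \<tau>' m)"
        "\<And>b. b \<in> carrier B' \<Longrightarrow> \<sigma>'' (\<alpha>' b) = \<sigma>' b"
        "\<And>b. b \<in> carrier B' \<Longrightarrow> r' b = inv\<^bsub>L\<^esub> \<tau>' \<otimes>\<^bsub>L\<^esub> r'' (\<alpha>' b) \<otimes>\<^bsub>L\<^esub> \<tau>'"
      using rel' unfolding E' E'' ext_rel_def by auto
    interpret E'': extension M L d \<rho> P B'' \<kappa>'' \<sigma>'' r'' by fact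
    have [simp]: "\<tau> \<in> carrier L" "\<tau>' \<in> carrier L"
      using tau tau' T_closed by auto
    have alpha_closed [simp]: "\<alpha> b \<in> carrier B'" if "b \<in> carrier B" for b
      using alpha(1) that by (auto simp: hom_def)
    have alpha'_closed [simp]: "\<alpha>' b \<in> carrier B''" if "b \<in> carrier B'" for b
      using alpha'(1) that by (auto simp: hom_def)
    \<comment> \<open>The morphism applied first contributes the right factor, hence the order of
      \<open>\<tau>'\<close> and \<open>\<tau>\<close>.\<close>
    have "\<alpha>' (\<alpha> (\<kappa> m)) = \<kappa>'' (\<rho> (\<tau>' \<otimes>\<^bsub>L\<^esub> \<tau>) m)" if "m \<in> carrier M" for m
      using that by (simp add: alpha alpha' action_comp)
    moreover have "\<sigma>'' (\<alpha>' (\<alpha> b)) = \<sigma> b" if "b \<in> carrier B" for b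
      using that by (simp add: alpha alpha')
    moreover have "inv\<^bsub>L\<^esub> (\<tau>' \<otimes>\<^bsub>L\<^esub> \<tau>) \<otimes>\<^bsub>L\<^esub> r'' (\<alpha>' (\<alpha> b)) \<otimes>\<^bsub>L\<^esub> (\<tau>' \<otimes>\<^bsub>L\<^esub> \<tau>) = r b"
      if "b \<in> carrier B" for b
      using that by (simp add: alpha(4) alpha'(4) L.m_assoc L.inv_mult_group)
    moreover have "\<alpha>' \<circ> \<alpha> \<in> hom B B''"
      using alpha(1) alpha'(1) by (rule hom_compose)
    ultimately show "(E, E'') \<in> ext_rel T"
      unfolding E E'' ext_rel_def using ext ext'' subgroup.m_closed[OF T tau' tau]
      by (auto intro!: exI[of _ "\<alpha>' \<circ> \<alpha>"] bexI[of _ "\<tau>' \<otimes>\<^bsub>L\<^esub> \<tau>"])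
  qed
qed

text \<open>A relation rather than a map, which avoids fixing a section of each extension.
  Extensionality puts the cochain into \<open>cocycles\<close>.\<close>

definition has_factor_set :: "('m, 'l, 'p, 'b) ext \<Rightarrow> ('m, 'l, 'p) cochain \<Rightarrow> bool" where
  "has_factor_set = (\<lambda>(B, \<kappa>, \<sigma>, r) (f, \<phi>).
     f \<in> extensional (carrier P \<times> carrier P) \<and> \<phi> \<in> extensional (carrier P) \<and>
     (\<exists>s. factor_set M L d \<rho> P B \<kappa> \<sigma> r s f \<phi>))"

text \<open>Morphisms and cochains \<open>t\<close> correspond for each fixed \<open>\<tau>\<close>.
  The pairs are reversed because the cocycle relations list the cocycle of the target first.\<close>

lemma has_factor_set_ext_rel_iff:
  assumes T: "subgroup T L" and "has_factor_set E c" "has_factor_set E' c'"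
  shows "(E, E') \<in> ext_rel T \<longleftrightarrow> (c', c) \<in> cocycle_rel T"
proof -
  obtain B \<kappa> \<sigma> r where E: "E = (B, \<kappa>, \<sigma>, r)" by (cases E)
  obtain B' \<kappa>' \<sigma>' r' where E': "E' = (B', \<kappa>', \<sigma>', r')" by (cases E')
  obtain f \<phi> where c: "c = (f, \<phi>)" by (cases c)
  obtain f' \<phi>' where c': "c' = (f', \<phi>')" by (cases c')
  obtain s where f: "f \<in> extensional (carrier P \<times> carrier P)" "\<phi> \<in> extensional (carrier P)"
    and F: "factor_set M L d \<rho> P B \<kappa> \<sigma> r s f \<phi>"
    using assms(2) unfolding has_factor_set_def E c by auto
  obtain s' where f': "f' \<in> extensional (carrier P \<times> carrier P)" "\<phi>' \<in> extensional (carrier P)"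
    and F': "factor_set M L d \<rho> P B' \<kappa>' \<sigma>' r' s' f' \<phi>'"
    using assms(3) unfolding has_factor_set_def E' c' by auto
  have ext: "extension M L d \<rho> P B \<kappa> \<sigma> r" "extension M L d \<rho> P B' \<kappa>' \<sigma>' r'"
    using F F' by (simp_all add: factor_set_def)
  have coc: "(f, \<phi>) \<in> cocycles M L d \<rho> P" "(f', \<phi>') \<in> cocycles M L d \<rho> P"
    using f f' factor_set.cocycle[OF F] factor_set.cocycle[OF F'] by (simp_all add: cocycles_iff)
  let ?mor = "\<lambda>\<tau> \<alpha>. \<alpha> \<in> hom B B' \<and> (\<forall>m \<in> carrier M. \<alpha> (\<kappa> m) = \<kappa>' (\<rho> \<tau> m)) \<and>
        (\<forall>b \<in> carrier B. \<sigma>' (\<alpha> b) = \<sigma> b) \<and>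
        (\<forall>b \<in> carrier B. inv\<^bsub>L\<^esub> \<tau> \<otimes>\<^bsub>L\<^esub> r' (\<alpha> b) \<otimes>\<^bsub>L\<^esub> \<tau> = r b)"
  let ?cob = "\<lambda>\<tau> t. t \<in> carrier P \<rightarrow> carrier M \<and>
        (\<forall>x \<in> carrier P. \<forall>y \<in> carrier P.
           f' (x, y) =
             inv\<^bsub>M\<^esub> t (x \<otimes>\<^bsub>P\<^esub> y) \<otimes>\<^bsub>M\<^esub> \<rho> \<tau> (f (x, y)) \<otimes>\<^bsub>M\<^esub> t x \<otimes>\<^bsub>M\<^esub> \<rho> (\<phi>' x) (t y)) \<and>
        (\<forall>x \<in> carrier P. \<phi> x = inv\<^bsub>L\<^esub> \<tau> \<otimes>\<^bsub>L\<^esub> d (t x) \<otimes>\<^bsub>L\<^esub> \<phi>' x \<otimes>\<^bsub>L\<^esub> \<tau>)"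
  have iff: "(\<exists>\<alpha>. ?mor \<tau> \<alpha>) \<longleftrightarrow> (\<exists>t. ?cob \<tau> t)" if "\<tau> \<in> T" for \<tau>
  proof -
    have "\<tau> \<in> carrier L" using subgroup.mem_carrier[OF T that] .
    then interpret factor_set_pair M L d \<rho> P B \<kappa> \<sigma> r s f \<phi> B' \<kappa>' \<sigma>' r' s' f' \<phi>' \<tau>
      using F F' ext by (simp add: factor_set_pair_def extension_pairI)
    show ?thesis
      using twisted_morphism_iff_coboundary
      unfolding twisted_morphism_def twisted_coboundary_def .
  qed
  have "(E, E') \<in> ext_rel T \<longleftrightarrow> (\<exists>\<tau>\<in>T. \<exists>\<alpha>. ?mor \<tau> \<alpha>)"
    unfolding E E' ext_rel_def using ext by auto
  also have "\<dots> \<longleftrightarrow> (\<exists>\<tau>\<in>T. \<exists>t. ?cob \<tau> t)"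
    by (rule bex_cong[OF refl iff])
  also have "\<dots> \<longleftrightarrow> (c', c) \<in> cocycle_rel T"
    unfolding c c' cocycle_rel_def using coc by auto
  finally show ?thesis .
qed

text \<open>The size assumption provides an injection along which the twisted product is transported
  into the type \<open>'b\<close>.\<close>

lemma exists_extension_with_factor_set:
  assumes "carrier M \<times> carrier P \<lesssim> (UNIV :: 'b set)" "c \<in> cocycles M L d \<rho> P"
  shows "\<exists>E :: ('m, 'l, 'p, 'b) ext. has_factor_set E c"
proof -
  obtain f \<phi> where c: "c = (f, \<phi>)" by (cases c)
  then interpret cocycle M L d \<rho> P f \<phi>
    using assms(2) by (simp add: cocycles_iff)
  interpret F: factor_set M L d \<rho> P twisted_product "\<lambda>m. (m \<otimes>\<^bsub>M\<^esub> f1, \<one>\<^bsub>P\<^esub>)" snd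
      "\<lambda>(m, x). d m \<otimes>\<^bsub>L\<^esub> \<phi> x" "\<lambda>x. (\<one>\<^bsub>M\<^esub>, x)" f \<phi>
    by (rule factor_set_twisted_product)
  obtain \<iota> :: "'m \<times> 'p \<Rightarrow> 'b" where "inj_on \<iota> (carrier twisted_product)"
    using assms(1) by (auto simp: lepoll_def)
  from F.transport[OF this] obtain B :: "'b monoid" and \<kappa> \<sigma> r s where
    "factor_set M L d \<rho> P B \<kappa> \<sigma> r s f \<phi>" by blast
  then have "has_factor_set (B, \<kappa>, \<sigma>, r) c"
    using assms(2) c by (auto simp: has_factor_set_def cocycles_iff)
  then show ?thesis by blast
qed

lemma bij_betw_ext_cocycle_classes:
  assumes T: "subgroup T L" and universe: "carrier M \<times> carrier P \<lesssim> (UNIV :: 'b set)"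
  shows "\<exists>h. bij_betw h ((extensions M L d \<rho> P :: ('m, 'l, 'p, 'b) ext set) // ext_rel T)
           (cocycles M L d \<rho> P // cocycle_rel T)"
proof (rule bij_betw_quotients_of_correspondence[where R = has_factor_set, OF equiv_ext_rel[OF T]])
  show "cocycle_rel T \<subseteq> cocycles M L d \<rho> P \<times> cocycles M L d \<rho> P"
    by (auto simp: cocycle_rel_def)
next
  fix E :: "('m, 'l, 'p, 'b) ext" and c assume "has_factor_set E c"
  then show "E \<in> extensions M L d \<rho> P \<and> c \<in> cocycles M L d \<rho> P"
    using factor_set.cocycle
    by (fastforce simp: has_factor_set_def cocycles_iff factor_set_def)
next
  fix E :: "('m, 'l, 'p, 'b) ext" assume "E \<in> extensions M L d \<rho> P"
  moreover obtain B \<kappa> \<sigma> r where E: "E = (B, \<kappa>, \<sigma>, r)" by (cases E)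
  ultimately interpret extension M L d \<rho> P B \<kappa> \<sigma> r by simp
  obtain s f \<phi> where "f \<in> carrier P \<times> carrier P \<rightarrow>\<^sub>E carrier M" "\<phi> \<in> carrier P \<rightarrow>\<^sub>E carrier L"
    "factor_set M L d \<rho> P B \<kappa> \<sigma> r s f \<phi>"
    using exists_factor_set by blast
  then have "has_factor_set E (f, \<phi>)"
    by (auto simp: has_factor_set_def E PiE_iff)
  then show "\<exists>c. has_factor_set E c" by blast
next
  fix c assume "c \<in> cocycles M L d \<rho> P"
  then show "\<exists>E :: ('m, 'l, 'p, 'b) ext. has_factor_set E c"
    by (rule exists_extension_with_factor_set[OF universe])
qed (rule has_factor_set_ext_rel_iff[OF T])

end

theorem corollary9:
  fixes M :: "('m, 'mm) monoid_scheme" and L :: "('l, 'll) monoid_scheme"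
    and d :: "'m \<Rightarrow> 'l" and \<rho> :: "'l \<Rightarrow> 'm \<Rightarrow> 'm" and P :: "('p, 'pp) monoid_scheme"
  assumes "crossed_module M L d \<rho>"
    and "group P"
    and universe: "carrier M \<times> carrier P \<lesssim> (UNIV :: 'b set)"
  shows "(\<exists>h. bij_betw h (Ext M L d \<rho> P :: ('m, 'l, 'p, 'b) ext set set) (pi2_hat M L d \<rho> P)) \<and>
         (\<exists>h. bij_betw h (wExt M L d \<rho> P :: ('m, 'l, 'p, 'b) ext set set) (pi2 M L d \<rho> P))"
proof -
  interpret crossed_module_coefficients M L d \<rho> P
    using assms(1,2) by (simp add: crossed_module_coefficients_def)
  \<comment> \<open>The two halves are the cases of the trivial subgroup and of the whole group
    \<open>L\<close>.\<close>
  show ?thesis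
    unfolding Ext_def pi2_hat_def wExt_def pi2_def congruence_eq weak_congruence_eq
      cohomologous_eq weakly_cohomologous_eq
    using bij_betw_ext_cocycle_classes[OF L.triv_subgroup universe]
      bij_betw_ext_cocycle_classes[OF L.subgroup_self universe] by blast
qed

end
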